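(* For each $n\in\mathbb N$, $\mathcal A_r^n$ is a commutative Banach algebra without unit, with approximate identity, isomorphic to $\mathcal B_r$. Similarly, $\mathcal A_c^n$ is a commutative Banach algebra without unit, with approximate identity, isomorphic to $\mathcal B_c$.
   Context: Write $\overline{\mathbb R}=[-\infty,\infty]$. A function $F:\overline{\mathbb R}\to\mathbb R$ is regulated if the one-sided limits $F(x-),F(x+)$ exist in $\mathbb R$ for every $x\in\mathbb R$ and the limits $\lim_{x\to\pm\infty}F(x)$ exist in $\mathbb R$; by convention $F(\pm\infty)$ equals these limits. $\mathcal B_r$ is the space of regulated $F$ with $F(-\infty)=0$ and $F(x)=F(x-)$ for all $x\in\mathbb R$; $\mathcal B_c$ is the space of continuous $F:\overline{\mathbb R}\to\mathbb R$ with $F(-\infty)=0$. Both carry the norm $\|F\|_\infty=\sup_{x\in\mathbb R}|F(x)|$ and pointwise multiplication. $\mathcal A_r^n$ (resp. $\mathcal A_c^n$) is the set of distributions $f$ on $\mathbb R$ with $f=F^{(n)}=D^nF$ (distributional derivative) for some $F\in\mathcal B_r$ (resp. $\mathcal B_c$); $F$ is unique (the primitive of $f$) and $\|f\|_{a,n}=\|F\|_\infty$. Multiplication in $\mathcal A_r^n$ and $\mathcal A_c^n$: if $f_1,f_2$ have primitives $F_1,F_2$ then $f_1f_2:=D^n(F_1F_2)$. A Banach algebra here is a real Banach space with an associative bilinear multiplication satisfying $\|uv\|\le\|u\|\|v\|$ (a unit is not required). It has an approximate identity if there is a sequence $(u_k)$ of elements with $\|v-u_kv\|\to0$ for each element $v$.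 *)

theory Defs
  imports "HOL-Analysis.Analysis" "HOL-Library.Function_Algebras"
begin

instantiation "fun" :: (type, scaleR) scaleR
begin

definition scaleR_fun :: "real \<Rightarrow> ('a \<Rightarrow> 'b) \<Rightarrow> 'a \<Rightarrow> 'b"
  where "scaleR_fun c f = (\<lambda>x. c *\<^sub>R f x)"

instance ..

end

instance "fun" :: (type, real_vector) real_vector
  by standard (simp_all add: scaleR_fun_def fun_eq_iff algebra_simps)

text \<open>
  The vector space operations are those of the ambient type; the carrier, the multiplication
  and the norm are parameters.  No unit is required.
\<close>

locale banach_algebra_on =
  fixes S :: "'a::real_vector set"
    and mul :: "'a \<Rightarrow> 'a \<Rightarrow> 'a"
    and nrm :: "'a \<Rightarrow> real"
  assumes subspace_carrier: "subspace S"
    and nrm_nonneg: "x \<in> S \<Longrightarrow> 0 \<le> nrm x"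
    and nrm_eq_0_iff: "x \<in> S \<Longrightarrow> nrm x = 0 \<longleftrightarrow> x = 0"
    and nrm_triangle: "x \<in> S \<Longrightarrow> y \<in> S \<Longrightarrow> nrm (x + y) \<le> nrm x + nrm y"
    and nrm_scaleR: "x \<in> S \<Longrightarrow> nrm (c *\<^sub>R x) = \<bar>c\<bar> * nrm x"
    and complete_carrier:
      "(\<And>k. X k \<in> S) \<Longrightarrow> (\<And>e. 0 < e \<Longrightarrow> \<exists>M. \<forall>j\<ge>M. \<forall>k\<ge>M. nrm (X j - X k) < e)
        \<Longrightarrow> \<exists>x\<in>S. (\<lambda>k. nrm (X k - x)) \<longlonglongrightarrow> 0"
    and mul_closed: "x \<in> S \<Longrightarrow> y \<in> S \<Longrightarrow> mul x y \<in> S"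
    and mul_assoc: "x \<in> S \<Longrightarrow> y \<in> S \<Longrightarrow> z \<in> S \<Longrightarrow> mul (mul x y) z = mul x (mul y z)"
    and mul_add_left: "x \<in> S \<Longrightarrow> y \<in> S \<Longrightarrow> z \<in> S \<Longrightarrow> mul (x + y) z = mul x z + mul y z"
    and mul_add_right: "x \<in> S \<Longrightarrow> y \<in> S \<Longrightarrow> z \<in> S \<Longrightarrow> mul x (y + z) = mul x y + mul x z"
    and mul_scaleR_left: "x \<in> S \<Longrightarrow> y \<in> S \<Longrightarrow> mul (c *\<^sub>R x) y = c *\<^sub>R mul x y"
    and mul_scaleR_right: "x \<in> S \<Longrightarrow> y \<in> S \<Longrightarrow> mul x (c *\<^sub>R y) = c *\<^sub>R mul x y"
    and nrm_mul_le: "x \<in> S \<Longrightarrow> y \<in> S \<Longrightarrow> nrm (mul x y) \<le> nrm x * nrm y"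

locale commutative_banach_algebra_on = banach_algebra_on +
  assumes mul_commute: "x \<in> S \<Longrightarrow> y \<in> S \<Longrightarrow> mul x y = mul y x"

definition has_unit_on :: "'a set \<Rightarrow> ('a \<Rightarrow> 'a \<Rightarrow> 'a) \<Rightarrow> bool"
  where "has_unit_on S mul \<longleftrightarrow> (\<exists>e\<in>S. \<forall>v\<in>S. mul e v = v \<and> mul v e = v)"

definition has_approximate_identity_on ::
    "'a::real_vector set \<Rightarrow> ('a \<Rightarrow> 'a \<Rightarrow> 'a) \<Rightarrow> ('a \<Rightarrow> real) \<Rightarrow> bool"
  where "has_approximate_identity_on S mul nrm \<longleftrightarrow>
    (\<exists>u :: nat \<Rightarrow> 'a. (\<forall>k. u k \<in> S) \<and> (\<forall>v\<in>S. (\<lambda>k. nrm (v - mul (u k) v)) \<longlonglongrightarrow> 0))"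

text \<open>Isomorphism of Banach algebras: all of the structure, including the norm, is preserved.\<close>

definition banach_algebras_isomorphic ::
    "'a::real_vector set \<Rightarrow> ('a \<Rightarrow> 'a \<Rightarrow> 'a) \<Rightarrow> ('a \<Rightarrow> real) \<Rightarrow>
     'b::real_vector set \<Rightarrow> ('b \<Rightarrow> 'b \<Rightarrow> 'b) \<Rightarrow> ('b \<Rightarrow> real) \<Rightarrow> bool"
  where "banach_algebras_isomorphic S mulS nrmS T mulT nrmT \<longleftrightarrow>
    (\<exists>\<Phi>. bij_betw \<Phi> S T \<and>
      (\<forall>x\<in>S. \<forall>y\<in>S. \<Phi> (x + y) = \<Phi> x + \<Phi> y) \<and>
      (\<forall>c. \<forall>x\<in>S. \<Phi> (c *\<^sub>R x) = c *\<^sub>R \<Phi> x) \<and>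
      (\<forall>x\<in>S. \<forall>y\<in>S. \<Phi> (mulS x y) = mulT (\<Phi> x) (\<Phi> y)) \<and>
      (\<forall>x\<in>S. nrmT (\<Phi> x) = nrmS x))"

definition smooth :: "(real \<Rightarrow> real) \<Rightarrow> bool"
  where "smooth \<phi> \<longleftrightarrow> (\<forall>k x. (deriv ^^ k) \<phi> differentiable at x)"

lemma higher_deriv_add:
  assumes "smooth \<phi>" "smooth \<psi>"
  shows "(deriv ^^ k) (\<lambda>x. \<phi> x + \<psi> x) = (\<lambda>x. (deriv ^^ k) \<phi> x + (deriv ^^ k) \<psi> x)"
proof (induction k)
  case (Suc k)
  have "(deriv ^^ k) \<phi> field_differentiable at x" "(deriv ^^ k) \<psi> field_differentiable at x" for x
    using assms unfolding smooth_def
    by (auto simp: field_differentiable_def real_differentiable_def)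
  then show ?case by (simp add: Suc)
qed simp

lemma higher_deriv_cmult:
  assumes "smooth \<phi>"
  shows "(deriv ^^ k) (\<lambda>x. c * \<phi> x) = (\<lambda>x. c * (deriv ^^ k) \<phi> x)"
proof (induction k)
  case (Suc k)
  have "(deriv ^^ k) \<phi> field_differentiable at x" for x
    using assms unfolding smooth_def
    by (auto simp: field_differentiable_def real_differentiable_def)
  then show ?case by (simp add: Suc)
qed simp

lemma smooth_add: "smooth \<phi> \<Longrightarrow> smooth \<psi> \<Longrightarrow> smooth (\<lambda>x. \<phi> x + \<psi> x)"
  by (auto simp: smooth_def[of "\<lambda>x. \<phi> x + \<psi> x"] higher_deriv_add)
     (auto simp: smooth_def)

lemma smooth_cmult: "smooth \<phi> \<Longrightarrow> smooth (\<lambda>x. c * \<phi> x)"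
  by (auto simp: smooth_def[of "\<lambda>x. c * \<phi> x"] higher_deriv_cmult)
     (auto simp: smooth_def)

lemma smooth_zero: "smooth (\<lambda>x. 0)"
proof -
  have "(deriv ^^ k) (\<lambda>x::real. 0::real) = (\<lambda>x. 0)" for k
    by (induction k) auto
  then show ?thesis by (simp add: smooth_def)
qed

lemma smooth_deriv: "smooth \<phi> \<Longrightarrow> smooth (deriv \<phi>)"
  unfolding smooth_def by (metis comp_apply funpow_Suc_right)

definition compactly_supported :: "(real \<Rightarrow> real) \<Rightarrow> bool"
  where "compactly_supported \<phi> \<longleftrightarrow> compact (closure {x. \<phi> x \<noteq> 0})"

lemma compactly_supported_subset:
  assumes "compactly_supported \<phi>" "{x. \<psi> x \<noteq> 0} \<subseteq> closure {x. \<phi> x \<noteq> 0}"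
  shows "compactly_supported \<psi>"
  using assms unfolding compactly_supported_def
  by (meson bounded_subset compact_closure compact_imp_bounded)

lemma compactly_supported_add:
  assumes "compactly_supported \<phi>" "compactly_supported \<psi>"
  shows "compactly_supported (\<lambda>x. \<phi> x + \<psi> x)"
proof -
  have "bounded ({x. \<phi> x \<noteq> 0} \<union> {x. \<psi> x \<noteq> 0})"
    using assms by (simp add: compactly_supported_def)
  then have "bounded {x. \<phi> x + \<psi> x \<noteq> 0}"
    by (rule bounded_subset) auto
  then show ?thesis by (simp add: compactly_supported_def)
qed

lemma compactly_supported_cmult:
  assumes "compactly_supported \<phi>"
  shows "compactly_supported (\<lambda>x. c * \<phi> x)"
  using assms by (rule compactly_supported_subset) (auto intro: closure_subset[THEN subsetD])

lemma compactly_supported_deriv: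
  assumes "compactly_supported \<phi>"
  shows "compactly_supported (deriv \<phi>)"
  using assms
proof (rule compactly_supported_subset, safe)
  fix x assume "deriv \<phi> x \<noteq> 0"
  show "x \<in> closure {x. \<phi> x \<noteq> 0}"
  proof (rule ccontr)
    assume "x \<notin> closure {x. \<phi> x \<noteq> 0}"
    then have "x \<in> - closure {x. \<phi> x \<noteq> 0}" by simp
    moreover have "open (- closure {x. \<phi> x \<noteq> 0})" by auto
    ultimately have "\<forall>\<^sub>F y in nhds x. y \<in> - closure {x. \<phi> x \<noteq> 0}"
      using eventually_nhds by blast
    then have "\<forall>\<^sub>F y in nhds x. \<phi> y = 0"
      by eventually_elim (metis (mono_tags, lifting) ComplD closure_subset mem_Collect_eq subsetD)
    then have "deriv \<phi> x = deriv (\<lambda>_. 0) x"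
      by (rule deriv_cong_ev) simp
    with \<open>deriv \<phi> x \<noteq> 0\<close> show False by simp
  qed
qed

typedef test_fun = "{\<phi> :: real \<Rightarrow> real. smooth \<phi> \<and> compactly_supported \<phi>}"
  by (rule exI[of _ "\<lambda>x. 0"]) (simp add: smooth_zero compactly_supported_def)

setup_lifting type_definition_test_fun

instantiation test_fun :: real_vector
begin

lift_definition zero_test_fun :: test_fun is "\<lambda>x. 0"
  by (simp add: smooth_zero compactly_supported_def)

lift_definition plus_test_fun :: "test_fun \<Rightarrow> test_fun \<Rightarrow> test_fun" is "\<lambda>\<phi> \<psi> x. \<phi> x + \<psi> x"
  by (simp add: smooth_add compactly_supported_add)

lift_definition scaleR_test_fun :: "real \<Rightarrow> test_fun \<Rightarrow> test_fun" is "\<lambda>c \<phi> x. c * \<phi> x"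
  by (simp add: smooth_cmult compactly_supported_cmult)

definition uminus_test_fun :: "test_fun \<Rightarrow> test_fun"
  where "uminus_test_fun \<phi> = (-1) *\<^sub>R \<phi>"

definition minus_test_fun :: "test_fun \<Rightarrow> test_fun \<Rightarrow> test_fun"
  where "minus_test_fun \<phi> \<psi> = \<phi> + - \<psi>"

instance
  by standard (simp_all add: uminus_test_fun_def minus_test_fun_def, (transfer, simp add: algebra_simps)+)

end

lift_definition test_deriv :: "test_fun \<Rightarrow> test_fun" is deriv
  by (simp add: smooth_deriv compactly_supported_deriv)

definition test_converges :: "(nat \<Rightarrow> test_fun) \<Rightarrow> test_fun \<Rightarrow> bool"
  where "test_converges \<Phi> \<phi> \<longleftrightarrow>
    (\<exists>K. compact K \<and> (\<forall>j. {x. Rep_test_fun (\<Phi> j) x \<noteq> 0} \<subseteq> K)) \<and>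
    (\<forall>m. uniform_limit UNIV (\<lambda>j. (deriv ^^ m) (Rep_test_fun (\<Phi> j)))
            ((deriv ^^ m) (Rep_test_fun \<phi>)) sequentially)"

definition distributions :: "(test_fun \<Rightarrow> real) set"
  where "distributions =
    {T. linear T \<and> (\<forall>\<Phi> \<phi>. test_converges \<Phi> \<phi> \<longrightarrow> (\<lambda>j. T (\<Phi> j)) \<longlonglongrightarrow> T \<phi>)}"

definition distribution_deriv :: "(test_fun \<Rightarrow> real) \<Rightarrow> test_fun \<Rightarrow> real"
  where "distribution_deriv T = (\<lambda>\<phi>. - T (test_deriv \<phi>))"

definition regular_distribution :: "(ereal \<Rightarrow> real) \<Rightarrow> test_fun \<Rightarrow> real"
  where "regular_distribution F = (\<lambda>\<phi>. LINT x|lborel. F (ereal x) * Rep_test_fun \<phi> x)"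

definition distribution_deriv_n :: "nat \<Rightarrow> (ereal \<Rightarrow> real) \<Rightarrow> test_fun \<Rightarrow> real"
  where "distribution_deriv_n n F = (distribution_deriv ^^ n) (regular_distribution F)"

definition regulated :: "(ereal \<Rightarrow> real) \<Rightarrow> bool"
  where "regulated F \<longleftrightarrow>
    (\<forall>x::real. (\<exists>l. ((\<lambda>t. F (ereal t)) \<longlongrightarrow> l) (at_left x)) \<and>
               (\<exists>l. ((\<lambda>t. F (ereal t)) \<longlongrightarrow> l) (at_right x))) \<and>
    ((\<lambda>t. F (ereal t)) \<longlongrightarrow> F \<infinity>) at_top \<and>
    ((\<lambda>t. F (ereal t)) \<longlongrightarrow> F (-\<infinity>)) at_bot"

definition B_r :: "(ereal \<Rightarrow> real) set"
  where "B_r = {F. regulated F \<and> F (-\<infinity>) = 0 \<and>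
    (\<forall>x::real. ((\<lambda>t. F (ereal t)) \<longlongrightarrow> F (ereal x)) (at_left x))}"

definition B_c :: "(ereal \<Rightarrow> real) set"
  where "B_c = {F. continuous_on UNIV F \<and> F (-\<infinity>) = 0}"

definition sup_norm :: "(ereal \<Rightarrow> real) \<Rightarrow> real"
  where "sup_norm F = (SUP x::real. \<bar>F (ereal x)\<bar>)"

text \<open>\<open>B\<close> is the space of primitives, either \<open>B_r\<close> or \<open>B_c\<close>.\<close>

definition integrable_distributions :: "(ereal \<Rightarrow> real) set \<Rightarrow> nat \<Rightarrow> (test_fun \<Rightarrow> real) set"
  where "integrable_distributions B n = {f \<in> distributions. \<exists>F\<in>B. f = distribution_deriv_n n F}"

definition primitive :: "(ereal \<Rightarrow> real) set \<Rightarrow> nat \<Rightarrow> (test_fun \<Rightarrow> real) \<Rightarrow> ereal \<Rightarrow> real"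
  where "primitive B n f = (THE F. F \<in> B \<and> f = distribution_deriv_n n F)"

definition distribution_mult ::
    "(ereal \<Rightarrow> real) set \<Rightarrow> nat \<Rightarrow> (test_fun \<Rightarrow> real) \<Rightarrow> (test_fun \<Rightarrow> real) \<Rightarrow> test_fun \<Rightarrow> real"
  where "distribution_mult B n f\<^sub>1 f\<^sub>2 =
    distribution_deriv_n n (primitive B n f\<^sub>1 * primitive B n f\<^sub>2)"

definition distribution_norm :: "(ereal \<Rightarrow> real) set \<Rightarrow> nat \<Rightarrow> (test_fun \<Rightarrow> real) \<Rightarrow> real"
  where "distribution_norm B n f = sup_norm (primitive B n f)"

definition A_r :: "nat \<Rightarrow> (test_fun \<Rightarrow> real) set"
  where "A_r n = integrable_distributions B_r n"

definition A_c :: "nat \<Rightarrow> (test_fun \<Rightarrow> real) set"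
  where "A_c n = integrable_distributions B_c n"

end

theory Submission
  imports Defs
begin

text \<open>
  Everything is transported from the space \<open>B\<close> of primitives along \<open>D\<^sup>n\<close>, so the point is that \<open>D\<^sup>n\<close> is
  injective on \<open>B\<close>. Call a distribution \<open>T\<close> vanishing at \<open>-\<infinity>\<close> if its translates towards \<open>-\<infinity>\<close> tend
  to \<open>0\<close> on each test function. Bounded functions with limit \<open>0\<close> at \<open>-\<infinity>\<close> have this property, and
  differentiation preserves it. If moreover \<open>T' = 0\<close>, then \<open>T\<close> is translation invariant, hence \<open>T = 0\<close>.
  Therefore \<open>D\<^sup>n F = 0\<close> forces \<open>F = 0\<close> as a distribution, and pointwise by left continuity. The algebra \<open>B\<close> has
  no unit because a unit would be \<open>1\<close> on the real line but tend to \<open>0\<close> at \<open>-\<infinity>\<close>; continuous ramps that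
  are \<open>1\<close> on \<open>[1 - k, \<infinity>]\<close> form an approximate identity.
\<close>

section \<open>Smooth functions\<close>

text \<open>A set \<open>C\<close> in which every member has a derivative that is again in
  \<open>C\<close> contains all iterated derivatives of its members. Smoothness thus reduces to
  exhibiting such a set, with no formula for higher derivatives.\<close>

lemma smooth_coinduct [consumes 1, case_names deriv]:
  assumes "f \<in> C"
    and deriv: "\<And>f. f \<in> C \<Longrightarrow> \<exists>g\<in>C. \<forall>x. (f has_real_derivative g x) (at x)"
  shows "smooth f"
proof -
  have "(deriv ^^ k) f \<in> C" for k
  proof (induction k)
    case (Suc k)
    then obtain g where "g \<in> C" "\<And>x. ((deriv ^^ k) f has_real_derivative g x) (at x)"
      using deriv by blast
    then have "(deriv ^^ Suc k) f = g" by (auto intro: DERIV_imp_deriv)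
    with \<open>g \<in> C\<close> show ?case by simp
  qed (use assms in simp)
  then show ?thesis
    unfolding smooth_def using deriv real_differentiable_def by blast
qed

lemma smooth_has_real_derivative: "smooth f \<Longrightarrow> (f has_real_derivative deriv f x) (at x)"
  unfolding smooth_def
  by (metis DERIV_deriv_iff_real_differentiable funpow_0)

lemma smooth_antiderivative:
  assumes "\<And>x. (f has_real_derivative g x) (at x)" "smooth g"
  shows "smooth f"
proof -
  \<comment> \<open>The set of smooth functions is already closed under \<open>deriv\<close>;
    adjoining \<open>f\<close> keeps it closed because the derivative of \<open>f\<close> is the
    smooth \<open>g\<close>.\<close>
  have "f \<in> insert f {g. smooth g}" by simp
  then show ?thesis
  proof (rule smooth_coinduct)
    fix h assume h: "h \<in> insert f {g. smooth g}"
    show "\<exists>g\<in>insert f {g. smooth g}. \<forall>x. (h has_real_derivative g x) (at x)"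
    proof (cases "h = f")
      case True
      then show ?thesis using assms by blast
    next
      case False
      then show ?thesis
        using h smooth_deriv smooth_has_real_derivative by (intro bexI[of _ "deriv h"]) auto
    qed
  qed
qed

lemma smooth_affine:
  assumes "smooth f"
  shows "smooth (\<lambda>x. f (a * x + b))"
proof -
  \<comment> \<open>The factor \<open>c\<close> collects the powers of \<open>a\<close> that the
    chain rule produces.\<close>
  let ?C = "{\<lambda>x. c * f (a * x + b) |c f. smooth f}"
  have "(\<lambda>x. f (a * x + b)) \<in> ?C"
    using assms by (auto intro!: exI[of _ 1] exI[of _ f])
  then show ?thesis
  proof (rule smooth_coinduct)
    fix h assume "h \<in> ?C"
    then obtain c f where h: "h = (\<lambda>x. c * f (a * x + b))" and f: "smooth f" by blast
    have "(h has_real_derivative (c * a) * deriv f (a * x + b)) (at x)" for x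
      unfolding h
      by (auto intro!: derivative_eq_intros DERIV_chain2[OF smooth_has_real_derivative[OF f]])
    moreover have "(\<lambda>x. (c * a) * deriv f (a * x + b)) \<in> ?C"
      using smooth_deriv[OF f] by blast
    ultimately show "\<exists>g\<in>?C. \<forall>x. (h has_real_derivative g x) (at x)"
      by (intro bexI[of _ "\<lambda>x. (c * a) * deriv f (a * x + b)"]) auto
  qed
qed

text \<open>Finite sums of products of smooth functions. The product rule maps this set into itself,
  so it serves as the coinduction set for \<open>smooth_mult\<close> in place of the Leibniz
  formula.\<close>

inductive_set smooth_products :: "(real \<Rightarrow> real) set" where
  mult: "smooth f \<Longrightarrow> smooth g \<Longrightarrow> (\<lambda>x. f x * g x) \<in> smooth_products"
| add: "f \<in> smooth_products \<Longrightarrow> g \<in> smooth_products \<Longrightarrow> (\<lambda>x. f x + g x) \<in> smooth_products"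

lemma smooth_mult:
  assumes "smooth f" "smooth g"
  shows "smooth (\<lambda>x. f x * g x)"
  using smooth_products.mult[OF assms]
proof (rule smooth_coinduct)
  fix h assume "h \<in> smooth_products"
  then show "\<exists>g\<in>smooth_products. \<forall>x. (h has_real_derivative g x) (at x)"
  proof induction
    case (mult f g)
    then have "(\<lambda>x. deriv f x * g x + f x * deriv g x) \<in> smooth_products"
      by (intro smooth_products.intros smooth_deriv)
    moreover have "((\<lambda>x. f x * g x) has_real_derivative deriv f x * g x + f x * deriv g x) (at x)" for x
      using DERIV_mult[OF mult[THEN smooth_has_real_derivative]] by (simp add: algebra_simps)
    ultimately show ?case
      by (intro bexI[of _ "\<lambda>x. deriv f x * g x + f x * deriv g x"]) auto
  next
    case (add f g)
    then obtain f' g' where "f' \<in> smooth_products" "g' \<in> smooth_products"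
      "\<And>x. (f has_real_derivative f' x) (at x)" "\<And>x. (g has_real_derivative g' x) (at x)" by blast
    then show ?case
      by (intro bexI[of _ "\<lambda>x. f' x + g' x"]) (auto intro: DERIV_add smooth_products.add)
  qed
qed

section \<open>Smooth bump functions\<close>

text \<open>The classical flat function exp(-1/x), extended by 0 to the left. The polynomial in 1/x
  makes the family closed under differentiation, so that coinduction applies to
  \<open>range flat\<close>.\<close>

definition flat :: "real poly \<Rightarrow> real \<Rightarrow> real"
  where "flat p x = (if x \<le> 0 then 0 else poly p (1 / x) * exp (- (1 / x)))"

lemma tendsto_poly_mult_exp_minus: "((\<lambda>y::real. poly p y * exp (- y)) \<longlongrightarrow> 0) at_top"
proof -
  have "((\<lambda>y. \<Sum>i\<le>degree p. coeff p i * (y ^ i / exp y)) \<longlongrightarrow> (\<Sum>i\<le>degree p. coeff p i * 0)) at_top"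
    by (intro tendsto_intros tendsto_power_div_exp_0)
  then show ?thesis
    by (simp add: poly_altdef sum_distrib_right exp_minus field_simps sum_divide_distrib)
qed

text \<open>The quotient is the difference quotient of \<open>flat p\<close> at 0. On the right the
  factor 1/x is absorbed into the polynomial as \<open>pCons 0 p\<close>, and the exponential wins
  after substituting y = 1/x.\<close>

lemma flat_tendsto_0: "((\<lambda>x. flat p x / x) \<longlongrightarrow> 0) (at 0)"
proof -
  have "((\<lambda>x. flat p x / x) \<longlongrightarrow> 0) (at_left 0)"
    by (rule tendsto_eventually) (auto simp: flat_def eventually_at_filter)
  moreover have "((\<lambda>x. flat p x / x) \<longlongrightarrow> 0) (at_right 0)"
  proof -
    have "((\<lambda>x. poly (pCons 0 p) (1 / x) * exp (- (1 / x))) \<longlongrightarrow> 0) (at_right (0::real))"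
      by (rule filterlim_compose[OF tendsto_poly_mult_exp_minus])
         (simp add: filterlim_inverse_at_top_right flip: inverse_eq_divide)
    moreover have "\<forall>\<^sub>F x in at_right 0. poly (pCons 0 p) (1 / x) * exp (- (1 / x)) = flat p x / x"
      by (auto simp: flat_def eventually_at_filter)
    ultimately show ?thesis by (rule Lim_transform_eventually)
  qed
  ultimately show ?thesis
    by (simp add: filterlim_split_at)
qed

text \<open>With y = 1/x the inner derivative is -y^2, and p(y) exp(-y) has y-derivative (p' - p)(y)
  exp(-y); this accounts for \<open>monom 1 2 * (p - pderiv p)\<close>.\<close>

lemma flat_has_real_derivative:
  "(flat p has_real_derivative flat (monom 1 2 * (p - pderiv p)) x) (at x)"
proof -
  consider "x < 0" | "x = 0" | "x > 0" by linarith
  then show ?thesis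
  proof cases
    case 1
    have "((\<lambda>x. 0) has_real_derivative flat (monom 1 2 * (p - pderiv p)) x) (at x)"
      using 1 by (simp add: flat_def)
    then show ?thesis
      by (rule has_field_derivative_transform_within_open[where S = "{..<0}"])
         (use 1 in \<open>auto simp: flat_def\<close>)
  next
    case 2
    then show ?thesis
      using flat_tendsto_0[of p] by (simp add: DERIV_def flat_def)
  next
    case 3
    have "((\<lambda>x. poly p (1 / x) * exp (- (1 / x))) has_real_derivative
      flat (monom 1 2 * (p - pderiv p)) x) (at x)"
      using 3 by (auto intro!: derivative_eq_intros DERIV_chain2[OF poly_DERIV]
        simp: flat_def poly_monom field_simps power2_eq_square)
    then show ?thesis
      by (rule has_field_derivative_transform_within_open[where S = "{0<..}"])
         (use 3 in \<open>auto simp: flat_def\<close>)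
  qed
qed

lemma smooth_flat: "smooth (flat p)"
proof -
  have "flat p \<in> range flat" by simp
  then show ?thesis
    by (rule smooth_coinduct) (use flat_has_real_derivative in blast)
qed

definition bump :: "real \<Rightarrow> real \<Rightarrow> real \<Rightarrow> real"
  where "bump a b x = flat 1 (x - a) * flat 1 (b - x)"

lemma smooth_bump: "smooth (bump a b)"
  using smooth_mult[OF smooth_affine[OF smooth_flat, of 1 1 "- a"] smooth_affine[OF smooth_flat, of 1 "- 1" b]]
  by (simp add: bump_def[abs_def])

lemma bump_pos: "a < x \<Longrightarrow> x < b \<Longrightarrow> 0 < bump a b x"
  by (simp add: bump_def flat_def)

lemma bump_eq_0: "\<not> (a < x \<and> x < b) \<Longrightarrow> bump a b x = 0"
  by (auto simp: bump_def flat_def)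

section \<open>Test functions and translations\<close>

lemma Rep_test_fun_diff: "Rep_test_fun (\<phi> - \<psi>) x = Rep_test_fun \<phi> x - Rep_test_fun \<psi> x"
  by (simp only: minus_test_fun_def uminus_test_fun_def plus_test_fun.rep_eq scaleR_test_fun.rep_eq)

lemma compactly_supported_iff: "compactly_supported f \<longleftrightarrow> (\<exists>a. \<forall>x. f x \<noteq> 0 \<longrightarrow> \<bar>x\<bar> \<le> a)"
  by (auto simp: compactly_supported_def bounded_iff)

lemma compactly_supported_bump: "compactly_supported (bump a b)"
  unfolding compactly_supported_iff
proof (intro exI allI impI)
  fix x assume "bump a b x \<noteq> 0"
  then have "a < x \<and> x < b" using bump_eq_0 by blast
  then show "\<bar>x\<bar> \<le> \<bar>a\<bar> + \<bar>b\<bar>" by linarith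
qed

lift_definition test_bump :: "real \<Rightarrow> real \<Rightarrow> test_fun" is bump
  by (simp add: smooth_bump compactly_supported_bump)

text \<open>For positive \<open>h\<close> the support moves by \<open>h\<close> towards
  -\<infinity>.\<close>

lift_definition test_shift :: "real \<Rightarrow> test_fun \<Rightarrow> test_fun" is "\<lambda>h f x. f (x + h)"
proof (intro conjI)
  fix h and f :: "real \<Rightarrow> real" assume f: "smooth f \<and> compactly_supported f"
  then show "smooth (\<lambda>x. f (x + h))"
    using smooth_affine[of f 1 h] by simp
  obtain a where "\<And>x. f x \<noteq> 0 \<Longrightarrow> \<bar>x\<bar> \<le> a"
    using f by (auto simp: compactly_supported_iff)
  then show "compactly_supported (\<lambda>x. f (x + h))"
    unfolding compactly_supported_iff by (intro exI[of _ "a + \<bar>h\<bar>"]) force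
qed

lemma test_deriv_shift: "test_deriv (test_shift h \<psi>) = test_shift h (test_deriv \<psi>)"
proof transfer
  fix h and f :: "real \<Rightarrow> real" assume "smooth f \<and> compactly_supported f"
  then have "(f has_real_derivative deriv f (x + h)) (at (x + h))" for x
    by (simp add: smooth_has_real_derivative)
  then show "deriv (\<lambda>x. f (x + h)) = (\<lambda>x. deriv f (x + h))"
    by (auto simp: fun_eq_iff DERIV_shift intro!: DERIV_imp_deriv)
qed

lemma continuous_on_smooth: "smooth f \<Longrightarrow> continuous_on A f"
  by (meson smooth_has_real_derivative DERIV_isCont continuous_at_imp_continuous_on)

lemma continuous_antiderivative_exists:
  fixes g :: "real \<Rightarrow> real"
  assumes "continuous_on UNIV g"
  obtains G where "\<And>x. (G has_real_derivative g x) (at x)"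
proof -
  have "\<exists>G. \<forall>x. (G has_vector_derivative g x) (at x)"
    using einterval_antiderivative[of "-\<infinity>" \<infinity> g] assms
    by (simp add: continuous_on_eq_continuous_at)
  then show ?thesis using that by (auto simp: has_real_derivative_iff_has_vector_derivative)
qed

text \<open>For an antiderivative \<open>G\<close> of \<psi>, the function G(x + h) - G(x) is the
  required \<phi>: \<open>G\<close> is constant on either side of the support of \<psi>, so the
  difference has compact support.\<close>

lemma test_shift_diff_is_deriv:
  "\<exists>\<phi>. test_deriv \<phi> = test_shift h \<psi> - \<psi>"
proof -
  obtain f where f: "f = Rep_test_fun \<psi>" by simp
  then have sm: "smooth f" and "compactly_supported f"
    using Rep_test_fun[of \<psi>] by auto
  then obtain a where a: "\<And>x. f x \<noteq> 0 \<Longrightarrow> \<bar>x\<bar> \<le> a"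
    by (auto simp: compactly_supported_iff)
  obtain G where G: "\<And>x. (G has_real_derivative f x) (at x)"
    using continuous_antiderivative_exists continuous_on_smooth sm by blast
  \<comment> \<open>The points \<open>x\<close> and \<open>y\<close> come in either order, since
    \<open>h\<close> may have either sign.\<close>
  have const: "G x = G y" if "\<And>z. min x y < z \<Longrightarrow> z < max x y \<Longrightarrow> f z = 0" for x y
  proof -
    have *: "G u = G v" if "u < v" "\<And>z. u < z \<Longrightarrow> z < v \<Longrightarrow> f z = 0" for u v
    proof -
      have "continuous_on {u..v} G"
        using G by (intro continuous_at_imp_continuous_on ballI DERIV_isCont)
      moreover have "(G has_real_derivative 0) (at z)" if "u < z" "z < v" for z
        using G[of z] \<open>\<And>z. u < z \<Longrightarrow> z < v \<Longrightarrow> f z = 0\<close>[OF that] by simp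
      ultimately show ?thesis
        by (intro DERIV_isconst_end[OF \<open>u < v\<close>, symmetric])
    qed
    show ?thesis
    proof (cases x y rule: linorder_cases)
      case less
      then show ?thesis by (rule *) (use that less in auto)
    next
      case greater
      then show ?thesis by (rule *[symmetric]) (use that greater in auto)
    qed simp
  qed
  let ?g = "\<lambda>x. G (x + h) - G x"
  have der: "(?g has_real_derivative f (x + h) - f x) (at x)" for x
    using DERIV_diff[OF G[of "x + h", unfolded DERIV_shift] G[of x]] .
  have "smooth (\<lambda>x. f (1 * x + h) + (- 1) * f x)"
    by (intro smooth_add smooth_affine smooth_cmult sm)
  then have "smooth ?g"
    using smooth_antiderivative[OF der] by simp
  moreover have "compactly_supported ?g"
    unfolding compactly_supported_iff
  proof (intro exI allI impI)
    fix x assume *: "?g x \<noteq> 0"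
    \<comment> \<open>Beyond this bound every point between \<open>x\<close> and
      \<open>x + h\<close> has modulus greater than \<open>a\<close>, where \<open>f\<close>
      vanishes.\<close>
    show "\<bar>x\<bar> \<le> \<bar>a\<bar> + \<bar>h\<bar>"
    proof (rule ccontr)
      assume "\<not> \<bar>x\<bar> \<le> \<bar>a\<bar> + \<bar>h\<bar>"
      then have "G (x + h) = G x"
        by (intro const) (use a in \<open>fastforce simp: min_def max_def split: if_splits\<close>)
      with * show False by simp
    qed
  qed
  ultimately obtain \<phi> where \<phi>: "Rep_test_fun \<phi> = ?g"
    using Abs_test_fun_inverse by blast
  have "Rep_test_fun (test_deriv \<phi>) = Rep_test_fun (test_shift h \<psi> - \<psi>)"
    by (simp add: fun_eq_iff test_deriv.rep_eq \<phi> Rep_test_fun_diff test_shift.rep_eq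
      DERIV_imp_deriv[OF der] flip: f)
  then show ?thesis using Rep_test_fun_inject by blast
qed

section \<open>Left-continuous regulated functions\<close>

text \<open>Each one-sided limit bounds \<open>F\<close> on its own side of \<open>x\<close>; the
  value at \<open>x\<close> itself, unrelated to the limits, is added to the bound.\<close>

lemma regulated_locally_bounded:
  assumes "regulated F"
  shows "\<exists>d>0. \<exists>C. \<forall>t. \<bar>t - x\<bar> < d \<longrightarrow> \<bar>F (ereal t)\<bar> \<le> C"
proof -
  obtain l r where "((\<lambda>t. F (ereal t)) \<longlongrightarrow> l) (at_left x)" "((\<lambda>t. F (ereal t)) \<longlongrightarrow> r) (at_right x)"
    using assms unfolding regulated_def by blast
  then have "\<forall>\<^sub>F t in at_left x. \<bar>F (ereal t)\<bar> < \<bar>l\<bar> + 1" "\<forall>\<^sub>F t in at_right x. \<bar>F (ereal t)\<bar> < \<bar>r\<bar> + 1"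
    by (auto intro!: order_tendstoD(2)[OF tendsto_rabs])
  then obtain b c where b: "b < x" "\<And>t. b < t \<Longrightarrow> t < x \<Longrightarrow> \<bar>F (ereal t)\<bar> < \<bar>l\<bar> + 1"
    and c: "x < c" "\<And>t. x < t \<Longrightarrow> t < c \<Longrightarrow> \<bar>F (ereal t)\<bar> < \<bar>r\<bar> + 1"
    unfolding eventually_at_left_field eventually_at_right_field by blast
  have "\<bar>F (ereal t)\<bar> \<le> \<bar>l\<bar> + 1 + (\<bar>r\<bar> + 1) + \<bar>F (ereal x)\<bar>" if "\<bar>t - x\<bar> < min (x - b) (c - x)" for t
    using b(2)[of t] c(2)[of t] that by (cases t x rule: linorder_cases) auto
  with b(1) c(1) show ?thesis
    by (intro exI[of _ "min (x - b) (c - x)"]) auto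
qed

text \<open>The limits at the two infinities control both tails, and bisection turns local
  boundedness into boundedness on the compact interval between them.\<close>

lemma regulated_bounded:
  assumes F: "regulated F"
  obtains M where "0 \<le> M" "\<And>x. \<bar>F x\<bar> \<le> M"
proof -
  have "((\<lambda>t. F (ereal t)) \<longlongrightarrow> F \<infinity>) at_top" "((\<lambda>t. F (ereal t)) \<longlongrightarrow> F (-\<infinity>)) at_bot"
    using F by (auto simp: regulated_def)
  then have "\<forall>\<^sub>F t in at_top. \<bar>F (ereal t)\<bar> < \<bar>F \<infinity>\<bar> + 1" "\<forall>\<^sub>F t in at_bot. \<bar>F (ereal t)\<bar> < \<bar>F (-\<infinity>)\<bar> + 1"
    by (auto intro!: order_tendstoD(2)[OF tendsto_rabs])
  then obtain b a where a: "\<And>t. t \<le> a \<Longrightarrow> \<bar>F (ereal t)\<bar> < \<bar>F (-\<infinity>)\<bar> + 1"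
    and b: "\<And>t. t \<ge> b \<Longrightarrow> \<bar>F (ereal t)\<bar> < \<bar>F \<infinity>\<bar> + 1"
    unfolding eventually_at_top_linorder eventually_at_bot_linorder by blast
  define bdd where "bdd u v \<longleftrightarrow> (\<exists>C. \<forall>t. u \<le> t \<and> t \<le> v \<longrightarrow> \<bar>F (ereal t)\<bar> \<le> C)" for u v
  \<comment> \<open>Nothing orders \<open>a\<close> and \<open>b\<close>, so the middle interval is
    taken between their minimum and maximum.\<close>
  have "min a b \<le> max a b" by simp
  then have "bdd (min a b) (max a b)"
  proof (induction rule: Bolzano)
    case (trans u v w)
    then obtain C D where "\<And>t. u \<le> t \<and> t \<le> v \<Longrightarrow> \<bar>F (ereal t)\<bar> \<le> C" "\<And>t. v \<le> t \<and> t \<le> w \<Longrightarrow> \<bar>F (ereal t)\<bar> \<le> D"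
      unfolding bdd_def by blast
    then show ?case
      unfolding bdd_def by (intro exI[of _ "max C D"]) (meson le_max_iff_disj linear)
  next
    case (local x)
    obtain d C where "d > 0" and C: "\<And>t. \<bar>t - x\<bar> < d \<Longrightarrow> \<bar>F (ereal t)\<bar> \<le> C"
      using regulated_locally_bounded[OF F, of x] by blast
    then show ?case
      unfolding bdd_def by (intro exI[of _ d] conjI allI impI exI[of _ C] C) auto
  qed
  then obtain C where C: "\<And>t. min a b \<le> t \<and> t \<le> max a b \<Longrightarrow> \<bar>F (ereal t)\<bar> \<le> C"
    unfolding bdd_def by blast
  show ?thesis
  proof
    fix x show "\<bar>F x\<bar> \<le> \<bar>C\<bar> + (\<bar>F \<infinity>\<bar> + 1) + (\<bar>F (-\<infinity>)\<bar> + 1)"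
    proof (cases x)
      case (real t)
      have "t \<le> a \<or> b \<le> t \<or> min a b \<le> t \<and> t \<le> max a b" by linarith
      then show ?thesis
        unfolding real
        by (elim disjE) (use a[of t] b[of t] C[of t] in \<open>linarith+\<close>)
    qed auto
  qed simp
qed

lemma B_r_bounded:
  assumes "F \<in> B_r"
  obtains M where "0 \<le> M" "\<And>x. \<bar>F x\<bar> \<le> M"
  using assms regulated_bounded unfolding B_r_def by blast

lemma B_r_left_continuous: "F \<in> B_r \<Longrightarrow> ((\<lambda>t. F (ereal t)) \<longlongrightarrow> F (ereal x)) (at_left x)"
  by (simp add: B_r_def)

lemma B_r_at_bot: "F \<in> B_r \<Longrightarrow> ((\<lambda>t. F (ereal t)) \<longlongrightarrow> 0) at_bot"
  by (auto simp: B_r_def regulated_def)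

lemma B_r_at_top: "F \<in> B_r \<Longrightarrow> ((\<lambda>t. F (ereal t)) \<longlongrightarrow> F \<infinity>) at_top"
  by (auto simp: B_r_def regulated_def)

lemma B_r_minus_infinity: "F \<in> B_r \<Longrightarrow> F (-\<infinity>) = 0"
  by (simp add: B_r_def)

lemma B_r_eqI:
  assumes "F \<in> B_r" "G \<in> B_r" "\<And>t. F (ereal t) = G (ereal t)"
  shows "F = G"
proof
  fix x
  have "F \<infinity> = G \<infinity>"
    using tendsto_unique[OF _ B_r_at_top[OF assms(1)]] B_r_at_top[OF assms(2)] assms(3) by simp
  then show "F x = G x"
    by (cases x) (use assms(3) assms(1,2)[THEN B_r_minus_infinity] in auto)
qed

lemma sup_norm_le: "(\<And>t. \<bar>F (ereal t)\<bar> \<le> c) \<Longrightarrow> sup_norm F \<le> c"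
  unfolding sup_norm_def by (rule cSUP_least) auto

text \<open>The supremum ranges over the reals only, but it also bounds the values at the
  infinities: one is a limit of real values, the other is 0.\<close>

lemma abs_le_sup_norm:
  assumes "F \<in> B_r"
  shows "\<bar>F x\<bar> \<le> sup_norm F"
proof -
  obtain M where "\<And>x. \<bar>F x\<bar> \<le> M" using B_r_bounded assms by blast
  then have real: "\<bar>F (ereal t)\<bar> \<le> sup_norm F" for t
    unfolding sup_norm_def by (intro cSUP_upper) (auto intro!: bdd_aboveI)
  then have "\<bar>F \<infinity>\<bar> \<le> sup_norm F"
    by (intro tendsto_upperbound[OF tendsto_rabs[OF B_r_at_top[OF assms]]]) auto
  moreover have "0 \<le> sup_norm F"
    using real[of 0] by linarith
  ultimately show ?thesis
    using real B_r_minus_infinity[OF assms] by (cases x) auto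
qed

text \<open>The step functions sampling \<open>F\<close> at the largest grid point strictly below \<open>t\<close> converge
  pointwise by left continuity.\<close>

lemma B_r_borel_measurable:
  assumes "F \<in> B_r"
  shows "(\<lambda>t. F (ereal t)) \<in> borel_measurable borel"
proof -
  \<comment> \<open>Ceiling minus one, instead of the floor, keeps \<open>s k t\<close> strictly
    below \<open>t\<close> even when \<open>t\<close> is a grid point, as convergence along
    \<open>at_left t\<close> demands.\<close>
  define s where "s k t = (real_of_int \<lceil>real (Suc k) * t\<rceil> - 1) / real (Suc k)" for k t
  have s: "s k t < t" "t - 1 / real (Suc k) \<le> s k t" for k t
  proof -
    have "real_of_int \<lceil>real (Suc k) * t\<rceil> - 1 < real (Suc k) * t" "real (Suc k) * t \<le> real_of_int \<lceil>real (Suc k) * t\<rceil>"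
      by linarith+
    then show "s k t < t" "t - 1 / real (Suc k) \<le> s k t"
      by (simp_all add: s_def field_simps del: of_nat_Suc)
  qed
  have "(\<lambda>k. s k t) \<longlonglongrightarrow> t" for t
  proof (rule tendsto_sandwich)
    show "(\<lambda>k. t - 1 / real (Suc k)) \<longlonglongrightarrow> t"
      using tendsto_diff[OF tendsto_const LIMSEQ_inverse_real_of_nat, of t] by (simp add: inverse_eq_divide)
    show "\<forall>\<^sub>F k in sequentially. s k t \<le> t" "\<forall>\<^sub>F k in sequentially. t - 1 / real (Suc k) \<le> s k t"
      using s less_imp_le[OF s(1)] by (simp_all del: of_nat_Suc)
  qed simp
  then have lim: "(\<lambda>k. F (ereal (s k t))) \<longlonglongrightarrow> F (ereal t)" for t
    by (intro filterlim_compose[OF B_r_left_continuous[OF assms]])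
      (auto simp: filterlim_at s less_imp_neq[OF s(1)])
  \<comment> \<open>The function factors through the integer-valued ceiling, and every function on
    the discrete space of integers is measurable.\<close>
  have "(\<lambda>t. F (ereal (s k t))) \<in> borel_measurable borel" for k
    unfolding s_def
    by (rule measurable_compose[where f = "\<lambda>t. \<lceil>real (Suc k) * t\<rceil>" and N = "count_space UNIV"]) simp_all
  then show ?thesis
    by (rule borel_measurable_LIMSEQ_real[OF lim])
qed

section \<open>Closure of \<open>B_r\<close> under uniform limits and algebra operations\<close>

text \<open>Interchange of limits when the existence of the outer limit is not known beforehand:
  passing to the limit along \<open>G\<close> in the uniform Cauchy estimate shows that
  \<open>l\<close> is Cauchy.\<close>

lemma tendsto_uniform_limit_at_filter:
  fixes X :: "nat \<Rightarrow> 'a \<Rightarrow> real"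
  assumes lim: "\<And>k. (X k \<longlongrightarrow> l k) G" and unif: "uniform_limit UNIV X F sequentially" and "G \<noteq> bot"
  obtains L where "(F \<longlongrightarrow> L) G" "l \<longlonglongrightarrow> L"
proof -
  have "Cauchy l"
  proof (rule metric_CauchyI)
    fix e :: real assume "0 < e"
    then have "uniformly_Cauchy_on UNIV X"
      using uniformly_convergent_Cauchy uniformly_convergentI unif by blast
    \<comment> \<open>Half of \<open>e\<close> is used because the strict estimate becomes a weak
      one in the limit along \<open>G\<close>.\<close>
    from this[unfolded uniformly_Cauchy_on_def, rule_format, of "e / 2"] \<open>0 < e\<close>
    obtain M where M: "\<And>x m n. m \<ge> M \<Longrightarrow> n \<ge> M \<Longrightarrow> dist (X m x) (X n x) < e / 2"
      by auto
    have "dist (l m) (l n) \<le> e / 2" if "m \<ge> M" "n \<ge> M" for m n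
      using M[OF that] by (intro tendsto_upperbound[OF tendsto_dist[OF lim lim] _ \<open>G \<noteq> bot\<close>])
        (intro always_eventually allI less_imp_le)
    moreover have "e / 2 < e" using \<open>0 < e\<close> by simp
    ultimately show "\<exists>M. \<forall>m\<ge>M. \<forall>n\<ge>M. dist (l m) (l n) < e"
      by (meson le_less_trans)
  qed
  then obtain L where "l \<longlonglongrightarrow> L" using Cauchy_convergent convergent_def by blast
  then show ?thesis
    by (intro that swap_uniform_limit'[OF _ _ unif]) (simp_all add: lim)
qed

text \<open>Every condition defining \<open>B_r\<close> is a limit along a filter or the value 0 at
  -\<infinity>, so interchange of limits and pointwise convergence give them all.\<close>

lemma B_r_uniform_limit:
  assumes X: "\<And>k. X k \<in> B_r" and unif: "uniform_limit UNIV X F sequentially"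
  shows "F \<in> B_r"
proof -
  have unif': "uniform_limit UNIV (\<lambda>k t. X k (ereal t)) (\<lambda>t. F (ereal t)) sequentially"
  proof (rule uniform_limitI)
    fix e :: real assume "0 < e"
    from uniform_limitD[OF unif this]
    show "\<forall>\<^sub>F k in sequentially. \<forall>t\<in>UNIV. dist (X k (ereal t)) (F (ereal t)) < e"
      by (rule eventually_mono) simp
  qed
  have pt: "(\<lambda>k. X k x) \<longlonglongrightarrow> F x" for x
    using tendsto_uniform_limitI[OF unif] by simp
  have reg: "regulated (X k)" for k using X by (simp add: B_r_def)
  have lim: "((\<lambda>t. F (ereal t)) \<longlongrightarrow> F x) G"
    if Xlim: "\<And>k. ((\<lambda>t. X k (ereal t)) \<longlongrightarrow> X k x) G" and G: "G \<noteq> bot" for x G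
  proof -
    obtain L where "((\<lambda>t. F (ereal t)) \<longlongrightarrow> L) G" "(\<lambda>k. X k x) \<longlonglongrightarrow> L"
      by (rule tendsto_uniform_limit_at_filter[OF Xlim unif' G])
    then show ?thesis using LIMSEQ_unique[OF pt] by blast
  qed
  \<comment> \<open>The right limits need not be values of \<open>X k\<close>, so they are chosen as
    a sequence \<open>l\<close> whose limit is the right limit of \<open>F\<close>.\<close>
  have "\<exists>l. ((\<lambda>t. F (ereal t)) \<longlongrightarrow> l) (at_right x)" for x
  proof -
    have "\<exists>l. ((\<lambda>t. X k (ereal t)) \<longlongrightarrow> l) (at_right x)" for k
      using reg by (simp add: regulated_def)
    then obtain l where "\<And>k. ((\<lambda>t. X k (ereal t)) \<longlongrightarrow> l k) (at_right x)" by metis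
    from tendsto_uniform_limit_at_filter[OF this unif' trivial_limit_at_right_real] show ?thesis by blast
  qed
  moreover have "((\<lambda>t. F (ereal t)) \<longlongrightarrow> F (ereal x)) (at_left x)" for x
    by (intro lim B_r_left_continuous X) simp
  moreover have "((\<lambda>t. F (ereal t)) \<longlongrightarrow> F \<infinity>) at_top"
    by (intro lim B_r_at_top X) simp
  moreover have "((\<lambda>t. F (ereal t)) \<longlongrightarrow> F (-\<infinity>)) at_bot"
    by (intro lim) (use reg in \<open>simp_all add: regulated_def\<close>)
  moreover have "F (-\<infinity>) = 0"
    using pt[of "-\<infinity>"] B_r_minus_infinity[OF X] by (simp add: LIMSEQ_const_iff)
  ultimately show ?thesis unfolding B_r_def regulated_def by blast
qed

text \<open>Left continuity supplies the left limits, so only the right limits remain as an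
  existence statement; the other conditions are limits with known values.\<close>

lemma B_r_iff:
  "F \<in> B_r \<longleftrightarrow> (\<forall>x. \<exists>l. ((\<lambda>t. F (ereal t)) \<longlongrightarrow> l) (at_right x)) \<and>
    (\<forall>x. ((\<lambda>t. F (ereal t)) \<longlongrightarrow> F (ereal x)) (at_left x)) \<and>
    ((\<lambda>t. F (ereal t)) \<longlongrightarrow> F \<infinity>) at_top \<and> ((\<lambda>t. F (ereal t)) \<longlongrightarrow> 0) at_bot \<and> F (-\<infinity>) = 0"
  by (auto simp: B_r_def regulated_def)

lemma B_r_right_limit:
  assumes "F \<in> B_r"
  obtains l where "((\<lambda>t. F (ereal t)) \<longlongrightarrow> l) (at_right x)"
  using assms unfolding B_r_iff by blast

lemma subspace_B_r: "subspace B_r"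
proof (rule subspaceI)
  show "0 \<in> B_r" by (auto simp: B_r_iff)
next
  fix F G assume FG: "F \<in> B_r" "G \<in> B_r"
  have "\<exists>l. ((\<lambda>t. F (ereal t) + G (ereal t)) \<longlongrightarrow> l) (at_right x)" for x
    using B_r_right_limit[OF FG(1)] B_r_right_limit[OF FG(2)] tendsto_add by metis
  then show "F + G \<in> B_r"
    using FG unfolding B_r_iff plus_fun_def by (auto intro!: tendsto_add tendsto_add_zero)
next
  fix c F assume F: "F \<in> B_r"
  have "\<exists>l. ((\<lambda>t. c * F (ereal t)) \<longlongrightarrow> l) (at_right x)" for x
    using B_r_right_limit[OF F] tendsto_mult_left by metis
  then show "c *\<^sub>R F \<in> B_r"
    using F unfolding B_r_iff scaleR_fun_def real_scaleR_def
    by (auto intro!: tendsto_mult_left tendsto_mult_right_zero)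
qed

lemma B_r_mult:
  assumes FG: "F \<in> B_r" "G \<in> B_r"
  shows "F * G \<in> B_r"
proof -
  have "\<exists>l. ((\<lambda>t. F (ereal t) * G (ereal t)) \<longlongrightarrow> l) (at_right x)" for x
    using B_r_right_limit[OF FG(1)] B_r_right_limit[OF FG(2)] tendsto_mult by metis
  then show ?thesis
    using FG unfolding B_r_iff times_fun_def by (auto intro!: tendsto_mult tendsto_mult_zero)
qed

section \<open>Continuous primitives\<close>

lemma tendsto_ereal_at_top: "(ereal \<longlongrightarrow> \<infinity>) at_top"
  by (simp add: tendsto_PInfty eventually_gt_at_top)

lemma tendsto_ereal_at_bot: "(ereal \<longlongrightarrow> -\<infinity>) at_bot"
  by (simp add: tendsto_MInfty eventually_gt_at_bot)

text \<open>All limits required by \<open>B_r\<close> come from composing \<open>F\<close> with the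
  embedding \<open>ereal\<close>, which converges in the extended line at real points and at both
  ends.\<close>

lemma B_c_subset_B_r: "B_c \<subseteq> B_r"
proof
  fix F assume "F \<in> B_c"
  then have 0: "F (-\<infinity>) = 0" and "isCont F x" for x
    by (auto simp: B_c_def continuous_on_eq_continuous_at)
  then have lim: "(g \<longlongrightarrow> x) G \<Longrightarrow> ((\<lambda>t. F (g t)) \<longlongrightarrow> F x) G" for g :: "real \<Rightarrow> ereal" and x G
    using isCont_tendsto_compose by blast
  have "((\<lambda>t. F (ereal t)) \<longlongrightarrow> F (ereal x)) (at x within A)" for x A
    by (intro lim tendsto_ereal tendsto_ident_at)
  moreover note lim[OF tendsto_ereal_at_top] lim[OF tendsto_ereal_at_bot]
  ultimately show "F \<in> B_r"
    using 0 unfolding B_r_def regulated_def by blast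
qed

lemma subspace_B_c: "subspace B_c"
  by (rule subspaceI)
     (auto simp: B_c_def scaleR_fun_def plus_fun_def zero_fun_def intro!: continuous_intros)

lemma B_c_mult: "F \<in> B_c \<Longrightarrow> G \<in> B_c \<Longrightarrow> F * G \<in> B_c"
  by (auto simp: B_c_def times_fun_def intro!: continuous_intros)

lemma B_c_uniform_limit:
  assumes X: "\<And>k. X k \<in> B_c" and unif: "uniform_limit UNIV X F sequentially"
  shows "F \<in> B_c"
proof -
  have "continuous_on UNIV F"
    by (rule uniform_limit_theorem[OF _ unif]) (use X in \<open>auto simp: B_c_def\<close>)
  moreover have "F \<in> B_r"
    using B_r_uniform_limit[OF _ unif] X B_c_subset_B_r by blast
  ultimately show ?thesis by (simp add: B_c_def B_r_minus_infinity)
qed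

text \<open>Zero up to -k, then rising with slope 1 to the value 1 at 1 - k, and constant from there
  to \<infinity>. One continuous family serves both \<open>B_c\<close> and
  \<open>B_r\<close>.\<close>

definition ramp :: "nat \<Rightarrow> ereal \<Rightarrow> real"
  where "ramp k x = real_of_ereal (max 0 (min 1 (x + ereal (real k))))"

lemma ramp_real: "ramp k (ereal t) = max 0 (min 1 (t + real k))"
proof -
  have "max 0 (min 1 (ereal t + ereal (real k))) = ereal (max 0 (min 1 (t + real k)))"
    by (simp add: max_def min_def zero_ereal_def one_ereal_def)
  then show ?thesis by (simp only: ramp_def real_of_ereal.simps)
qed

lemma ramp_in_B_c: "ramp k \<in> B_c"
proof -
  have "continuous_on UNIV (\<lambda>x. x + ereal (real k))"
    by (auto simp: continuous_on_def intro!: tendsto_cadd_ereal tendsto_ident_at)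
  \<comment> \<open>Truncation to [0, 1] avoids the infinite values, at which
    \<open>real_of_ereal\<close> is not continuous.\<close>
  moreover have "max 0 (min 1 y) \<noteq> (\<infinity>::ereal)" "max 0 (min 1 y) \<noteq> (-\<infinity>::ereal)" for y
    by (cases y; simp add: max_def min_def)+
  ultimately have "continuous_on UNIV (ramp k)"
    unfolding ramp_def
    by (intro continuous_on_compose2[OF continuous_on_real] continuous_on_max continuous_on_min
        continuous_on_const) auto
  then show ?thesis by (simp add: B_c_def ramp_def)
qed

section \<open>Distributional derivatives\<close>

text \<open>Provides the integrable majorant, a multiple of the indicator of an interval, for the
  integrability and dominated convergence arguments.\<close>

lemma test_fun_bounds:
  obtains C a where "0 \<le> C" "\<And>x. \<bar>Rep_test_fun \<psi> x\<bar> \<le> C * indicator {-a..a} x"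
proof -
  have sm: "smooth (Rep_test_fun \<psi>)" and "compactly_supported (Rep_test_fun \<psi>)"
    using Rep_test_fun[of \<psi>] by auto
  then obtain a where a: "\<And>x. Rep_test_fun \<psi> x \<noteq> 0 \<Longrightarrow> \<bar>x\<bar> \<le> a"
    by (auto simp: compactly_supported_iff)
  have "bounded (Rep_test_fun \<psi> ` {-a..a})"
    by (intro compact_imp_bounded compact_continuous_image continuous_on_smooth sm) simp
  then obtain C where "\<And>y. y \<in> Rep_test_fun \<psi> ` {-a..a} \<Longrightarrow> norm y \<le> C"
    unfolding bounded_iff by blast
  then have C: "\<bar>Rep_test_fun \<psi> x\<bar> \<le> C" if "x \<in> {-a..a}" for x
    using that by fastforce
  show ?thesis
  proof
    show "\<bar>Rep_test_fun \<psi> x\<bar> \<le> \<bar>C\<bar> * indicator {-a..a} x" for x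
    proof (cases "x \<in> {-a..a}")
      case True
      then show ?thesis using C[of x] by simp
    next
      case False
      then have "\<not> \<bar>x\<bar> \<le> a" by auto
      then have "Rep_test_fun \<psi> x = 0" using a by blast
      then show ?thesis by simp
    qed
  qed simp
qed

lemma test_fun_borel_measurable [measurable]: "Rep_test_fun \<psi> \<in> borel_measurable borel"
  using Rep_test_fun[of \<psi>] by (intro borel_measurable_continuous_onI continuous_on_smooth) simp

lemma integrable_indicator_Icc: "integrable lborel (\<lambda>x. C * indicator {-a..a::real} x :: real)"
  by (intro integrable_mult_right integrable_real_indicator) (auto simp: emeasure_lborel_Icc_eq)

lemma integrable_mult_test_fun:
  assumes F: "F \<in> B_r"
  shows "integrable lborel (\<lambda>x. F (ereal x) * Rep_test_fun \<psi> x)"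
proof -
  note [measurable] = B_r_borel_measurable[OF F]
  obtain M where M: "0 \<le> M" "\<And>x. \<bar>F x\<bar> \<le> M" using B_r_bounded[OF F] by blast
  obtain C a where C: "0 \<le> C" "\<And>x. \<bar>Rep_test_fun \<psi> x\<bar> \<le> C * indicator {-a..a} x"
    by (rule test_fun_bounds[of \<psi>]) (rule that)
  have "norm (F (ereal x) * Rep_test_fun \<psi> x) \<le> norm ((M * C) * indicator {-a..a} x)" for x
    using mult_mono[OF M(2) C(2)] M(1) C(1) by (simp add: abs_mult mult.assoc)
  then show ?thesis
    by (intro Bochner_Integration.integrable_bound[OF integrable_indicator_Icc]) auto
qed

lemma linear_regular_distribution:
  assumes "F \<in> B_r"
  shows "linear (regular_distribution F)"
  using integrable_mult_test_fun[OF assms]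
  by (intro linearI) (simp_all add: regular_distribution_def plus_test_fun.rep_eq
    scaleR_test_fun.rep_eq distrib_left mult.left_commute)

text \<open>Dominated convergence: the common compact support and uniform convergence yield one
  majorant for a tail of the sequence.\<close>

lemma continuous_regular_distribution:
  assumes F: "F \<in> B_r" and conv: "test_converges \<Phi> \<phi>"
  shows "(\<lambda>j. regular_distribution F (\<Phi> j)) \<longlonglongrightarrow> regular_distribution F \<phi>"
proof -
  note [measurable] = B_r_borel_measurable[OF F]
  obtain M where M: "0 \<le> M" "\<And>x. \<bar>F x\<bar> \<le> M" using B_r_bounded[OF F] by blast
  obtain K where "compact K" and K: "\<And>j x. Rep_test_fun (\<Phi> j) x \<noteq> 0 \<Longrightarrow> x \<in> K"
    using conv unfolding test_converges_def by blast
  then obtain a where a: "\<And>x. x \<in> K \<Longrightarrow> \<bar>x\<bar> \<le> a"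
    using compact_imp_bounded[of K] unfolding bounded_real by blast
  obtain C b where C: "0 \<le> C" "\<And>x. \<bar>Rep_test_fun \<phi> x\<bar> \<le> C * indicator {-b..b} x"
    by (rule test_fun_bounds[of \<phi>]) (rule that)
  have unif: "uniform_limit UNIV (\<lambda>j. Rep_test_fun (\<Phi> j)) (Rep_test_fun \<phi>) sequentially"
  proof -
    have "\<forall>m. uniform_limit UNIV (\<lambda>j. (deriv ^^ m) (Rep_test_fun (\<Phi> j)))
        ((deriv ^^ m) (Rep_test_fun \<phi>)) sequentially"
      using conv unfolding test_converges_def by (rule conjunct2)
    from spec[OF this, of 0] show ?thesis by simp
  qed
  then have "\<forall>\<^sub>F j in sequentially. \<forall>x\<in>UNIV. dist (Rep_test_fun (\<Phi> j) x) (Rep_test_fun \<phi> x) < 1"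
    by (rule uniform_limitD) simp
  then obtain N where N: "\<And>j x. j \<ge> N \<Longrightarrow> dist (Rep_test_fun (\<Phi> j) x) (Rep_test_fun \<phi> x) < 1"
    unfolding eventually_sequentially by blast
  \<comment> \<open>From index \<open>N\<close> on the functions differ from \<phi> by less than 1,
    hence \<open>C + 1\<close>; shifting the sequence by \<open>N\<close> makes the bound hold for
    every \<open>j\<close>.\<close>
  have bound: "\<bar>Rep_test_fun (\<Phi> (j + N)) x\<bar> \<le> (C + 1) * indicator {-a..a} x" for j x
  proof (cases "x \<in> {-a..a}")
    case True
    have "\<bar>Rep_test_fun \<phi> x\<bar> \<le> C"
      using C(2)[of x] C(1) by (cases "x \<in> {-b..b}") auto
    then show ?thesis using N[of "j + N" x] True by (simp add: dist_real_def)
  next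
    case False
    then have "\<not> \<bar>x\<bar> \<le> a" by auto
    then have "Rep_test_fun (\<Phi> (j + N)) x = 0" using K a by blast
    then show ?thesis using C(1) by simp
  qed
  have "norm (F (ereal x) * Rep_test_fun (\<Phi> (j + N)) x) \<le> (M * (C + 1)) * indicator {-a..a} x" for j x
    using mult_mono[OF M(2) bound] M(1) by (simp add: abs_mult mult.assoc)
  moreover have "(\<lambda>j. F (ereal x) * Rep_test_fun (\<Phi> (j + N)) x) \<longlonglongrightarrow> F (ereal x) * Rep_test_fun \<phi> x" for x
    using tendsto_uniform_limitI[OF unif, of x]
    by (intro tendsto_mult_left LIMSEQ_ignore_initial_segment) simp
  ultimately have "(\<lambda>j. regular_distribution F (\<Phi> (j + N))) \<longlonglongrightarrow> regular_distribution F \<phi>"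
    unfolding regular_distribution_def
    by (intro integral_dominated_convergence[OF _ _ integrable_indicator_Icc]) auto
  then show ?thesis by (rule LIMSEQ_offset)
qed

lemma regular_distribution_in_distributions:
  "F \<in> B_r \<Longrightarrow> regular_distribution F \<in> distributions"
  by (simp add: distributions_def linear_regular_distribution continuous_regular_distribution)

section \<open>Derivatives of test functions and of distributions\<close>

lemma linear_test_deriv: "linear test_deriv"
proof (rule linearI)
  have has_deriv: "(Rep_test_fun \<phi> has_real_derivative deriv (Rep_test_fun \<phi>) x) (at x)" for \<phi> x
    using Rep_test_fun[of \<phi>] smooth_has_real_derivative by blast
  show "test_deriv (\<phi> + \<psi>) = test_deriv \<phi> + test_deriv \<psi>" for \<phi> \<psi>
    by (simp add: fun_eq_iff test_deriv.rep_eq plus_test_fun.rep_eq flip: Rep_test_fun_inject)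
       (intro allI DERIV_imp_deriv DERIV_add has_deriv)
  show "test_deriv (c *\<^sub>R \<phi>) = c *\<^sub>R test_deriv \<phi>" for c \<phi>
    by (simp add: fun_eq_iff test_deriv.rep_eq scaleR_test_fun.rep_eq flip: Rep_test_fun_inject)
       (intro allI DERIV_imp_deriv DERIV_cmult has_deriv)
qed

lemma deriv_eq_0_outside_closed:
  assumes "closed K" "{x. f x \<noteq> 0} \<subseteq> K" "x \<notin> K"
  shows "deriv f x = (0::real)"
proof -
  have "\<forall>\<^sub>F y in nhds x. f y = 0"
    using eventually_nhds_in_open[of "- K" x] assms by (auto elim: eventually_mono simp: open_Compl)
  then have "deriv f x = deriv (\<lambda>_. 0) x"
    by (intro deriv_cong_ev) simp_all
  then show ?thesis by simp
qed

lemma test_converges_deriv: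
  assumes "test_converges \<Phi> \<phi>"
  shows "test_converges (\<lambda>j. test_deriv (\<Phi> j)) (test_deriv \<phi>)"
proof -
  obtain K where K: "compact K" "\<And>j. {x. Rep_test_fun (\<Phi> j) x \<noteq> 0} \<subseteq> K"
    and unif: "\<And>m. uniform_limit UNIV (\<lambda>j. (deriv ^^ m) (Rep_test_fun (\<Phi> j)))
      ((deriv ^^ m) (Rep_test_fun \<phi>)) sequentially"
    using assms unfolding test_converges_def by blast
  have "{x. Rep_test_fun (test_deriv (\<Phi> j)) x \<noteq> 0} \<subseteq> K" for j
    using deriv_eq_0_outside_closed[OF compact_imp_closed[OF K(1)] K(2)]
    by (auto simp: test_deriv.rep_eq)
  \<comment> \<open>The \<open>m\<close>-th derivative of the derivative is the derivative of order
    \<open>Suc m\<close>.\<close>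
  moreover have "uniform_limit UNIV (\<lambda>j. (deriv ^^ m) (Rep_test_fun (test_deriv (\<Phi> j))))
      ((deriv ^^ m) (Rep_test_fun (test_deriv \<phi>))) sequentially" for m
    using unif[of "Suc m"] by (simp add: test_deriv.rep_eq funpow_swap1)
  ultimately show ?thesis
    unfolding test_converges_def using K(1) by blast
qed

lemma distribution_deriv_in_distributions:
  assumes "T \<in> distributions"
  shows "distribution_deriv T \<in> distributions"
proof -
  have "linear T" using assms by (simp add: distributions_def)
  then have "linear (\<lambda>\<phi>. - T (test_deriv \<phi>))"
    using linear_compose_neg[OF linear_compose[OF linear_test_deriv]] by (simp add: o_def)
  then show ?thesis
    using assms test_converges_deriv by (auto simp: distributions_def distribution_deriv_def intro: tendsto_minus)
qed

lemma distribution_deriv_n_0: "distribution_deriv_n 0 F = regular_distribution F"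
  by (simp add: distribution_deriv_n_def)

lemma distribution_deriv_n_Suc:
  "distribution_deriv_n (Suc n) F = distribution_deriv (distribution_deriv_n n F)"
  by (simp add: distribution_deriv_n_def)

lemma distribution_deriv_n_in_distributions:
  assumes "F \<in> B_r"
  shows "distribution_deriv_n n F \<in> distributions"
proof (induction n)
  case 0
  show ?case
    unfolding distribution_deriv_n_0 using assms by (rule regular_distribution_in_distributions)
next
  case (Suc n)
  then show ?case by (simp add: distribution_deriv_n_Suc distribution_deriv_in_distributions)
qed

lemma regular_distribution_add:
  assumes "F \<in> B_r" "G \<in> B_r"
  shows "regular_distribution (F + G) = regular_distribution F + regular_distribution G"
proof
  fix \<psi> show "regular_distribution (F + G) \<psi> = (regular_distribution F + regular_distribution G) \<psi>"
    using assms[THEN integrable_mult_test_fun] by (simp add: regular_distribution_def distrib_right)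
qed

lemma regular_distribution_scaleR:
  "regular_distribution (c *\<^sub>R F) = c *\<^sub>R regular_distribution F"
proof
  fix \<psi> show "regular_distribution (c *\<^sub>R F) \<psi> = (c *\<^sub>R regular_distribution F) \<psi>"
    by (simp add: regular_distribution_def scaleR_fun_def mult.assoc)
qed

lemma distribution_deriv_n_add:
  assumes "F \<in> B_r" "G \<in> B_r"
  shows "distribution_deriv_n n (F + G) = distribution_deriv_n n F + distribution_deriv_n n G"
proof (induction n)
  case 0
  show ?case unfolding distribution_deriv_n_0 using assms by (rule regular_distribution_add)
next
  case (Suc n)
  then show ?case by (simp add: distribution_deriv_n_Suc distribution_deriv_def fun_eq_iff)
qed

lemma distribution_deriv_n_scaleR:
  "distribution_deriv_n n (c *\<^sub>R F) = c *\<^sub>R distribution_deriv_n n F"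
proof (induction n)
  case 0
  show ?case unfolding distribution_deriv_n_0 by (rule regular_distribution_scaleR)
next
  case (Suc n)
  then show ?case
    by (simp add: distribution_deriv_n_Suc distribution_deriv_def fun_eq_iff scaleR_fun_def)
qed

section \<open>Uniqueness of the primitive\<close>

text \<open>A substitute, meaningful for distributions, for the condition of having value 0 at
  -\<infinity>. It fixes the constant of integration at every order of differentiation.\<close>

definition vanishes_at_minus_infinity :: "(test_fun \<Rightarrow> real) \<Rightarrow> bool"
  where "vanishes_at_minus_infinity T \<longleftrightarrow> (\<forall>\<psi>. (\<lambda>k. T (test_shift (real k) \<psi>)) \<longlonglongrightarrow> 0)"

lemma regular_distribution_vanishes_at_minus_infinity:
  assumes F: "F \<in> B_r"
  shows "vanishes_at_minus_infinity (regular_distribution F)"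
  unfolding vanishes_at_minus_infinity_def
proof
  fix \<psi>
  note [measurable] = B_r_borel_measurable[OF F]
  obtain M where M: "0 \<le> M" "\<And>x. \<bar>F x\<bar> \<le> M" using B_r_bounded[OF F] by blast
  obtain C a where C: "0 \<le> C" "\<And>x. \<bar>Rep_test_fun \<psi> x\<bar> \<le> C * indicator {-a..a} x"
    by (rule test_fun_bounds[of \<psi>]) (rule that)
  \<comment> \<open>Substituting x - k moves the translation onto \<open>F\<close>, which leaves the
    fixed majorant of \<psi> in place while the factor \<open>F\<close> tends to 0
    pointwise.\<close>
  have shift: "regular_distribution F (test_shift (real k) \<psi>)
      = (LINT x|lborel. F (ereal (- real k + x)) * Rep_test_fun \<psi> x)" for k
    unfolding regular_distribution_def
    by (subst lborel_integral_real_affine[of 1 _ "- real k"]) (simp_all add: test_shift.rep_eq)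
  have "norm (F (ereal (- real k + x)) * Rep_test_fun \<psi> x) \<le> (M * C) * indicator {-a..a} x" for k x
    using mult_mono[OF M(2) C(2)] M(1) C(1) by (simp add: abs_mult mult.assoc)
  moreover have "(\<lambda>k. F (ereal (- real k + x)) * Rep_test_fun \<psi> x) \<longlonglongrightarrow> 0" for x
  proof -
    have "filterlim (\<lambda>k. x + - real k) at_bot sequentially"
      by (intro filterlim_tendsto_add_at_bot_iff[OF tendsto_const, THEN iffD2]
        filterlim_compose[OF filterlim_uminus_at_bot_at_top filterlim_real_sequentially])
    then have "(\<lambda>k. F (ereal (x + - real k))) \<longlonglongrightarrow> 0"
      by (rule filterlim_compose[OF B_r_at_bot[OF F]])
    then show ?thesis
      by (intro tendsto_mult_left_zero) (simp add: add.commute)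
  qed
  ultimately have "(\<lambda>k. LINT x|lborel. F (ereal (- real k + x)) * Rep_test_fun \<psi> x)
      \<longlonglongrightarrow> (LINT x::real|lborel. 0)"
    by (intro integral_dominated_convergence[OF _ _ integrable_indicator_Icc[of "M * C" a]]) auto
  then show "(\<lambda>k. regular_distribution F (test_shift (real k) \<psi>)) \<longlonglongrightarrow> 0"
    by (simp add: shift)
qed

text \<open>Differentiation commutes with translation, so the claim for \<psi> is the hypothesis for
  the derivative of \<psi>.\<close>

lemma distribution_deriv_vanishes_at_minus_infinity:
  assumes "vanishes_at_minus_infinity T"
  shows "vanishes_at_minus_infinity (distribution_deriv T)"
  unfolding vanishes_at_minus_infinity_def distribution_deriv_def test_deriv_shift
proof
  fix \<psi>
  have "(\<lambda>k. T (test_shift (real k) (test_deriv \<psi>))) \<longlonglongrightarrow> 0"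
    using assms by (simp add: vanishes_at_minus_infinity_def)
  from tendsto_minus[OF this]
  show "(\<lambda>k. - T (test_shift (real k) (test_deriv \<psi>))) \<longlonglongrightarrow> 0" by simp
qed

lemma distribution_deriv_n_vanishes_at_minus_infinity:
  assumes "F \<in> B_r"
  shows "vanishes_at_minus_infinity (distribution_deriv_n n F)"
proof (induction n)
  case 0
  show ?case
    unfolding distribution_deriv_n_0 using assms by (rule regular_distribution_vanishes_at_minus_infinity)
next
  case (Suc n)
  then show ?case by (simp add: distribution_deriv_n_Suc distribution_deriv_vanishes_at_minus_infinity)
qed

text \<open>A distribution with zero derivative is translation invariant, because every difference
  \<open>test_shift h \<psi> - \<psi>\<close> is the derivative of a test function.\<close>

lemma distribution_deriv_eq_0_imp:
  assumes "T \<in> distributions" "vanishes_at_minus_infinity T" "distribution_deriv T = 0"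
  shows "T = 0"
proof
  fix \<psi>
  have "linear T" using assms(1) by (simp add: distributions_def)
  have "T (test_shift h \<psi>) = T \<psi>" for h
  proof -
    obtain \<phi> where \<phi>: "test_deriv \<phi> = test_shift h \<psi> - \<psi>"
      using test_shift_diff_is_deriv by blast
    have "T (test_deriv \<phi>) = 0"
      using fun_cong[OF assms(3), of \<phi>] by (simp add: distribution_deriv_def)
    then show ?thesis
      by (simp add: \<phi> linear_diff[OF \<open>linear T\<close>])
  qed
  moreover have "(\<lambda>k. T (test_shift (real k) \<psi>)) \<longlonglongrightarrow> 0"
    using assms(2) by (simp add: vanishes_at_minus_infinity_def)
  ultimately show "T \<psi> = 0 \<psi>"
    by (simp add: LIMSEQ_const_iff)
qed

text \<open>A positive value at \<open>x\<close> persists on some interval to the left of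
  \<open>x\<close> by left continuity. Testing against a bump supported there gives a nonnegative
  integrand with integral 0 that is positive on an interval.\<close>

lemma regular_distribution_eq_0_imp_nonpos:
  assumes F: "F \<in> B_r" and "regular_distribution F = 0"
  shows "F (ereal x) \<le> 0"
proof (rule ccontr)
  assume "\<not> F (ereal x) \<le> 0"
  then have "\<forall>\<^sub>F t in at_left x. 0 < F (ereal t)"
    by (intro order_tendstoD(1)[OF B_r_left_continuous[OF F]]) simp
  then obtain b where b: "b < x" "\<And>t. b < t \<Longrightarrow> t < x \<Longrightarrow> 0 < F (ereal t)"
    unfolding eventually_at_left_field by blast
  let ?f = "\<lambda>t. F (ereal t) * Rep_test_fun (test_bump b x) t"
  have pos: "0 < ?f t" if "b < t" "t < x" for t
    using that b(2) bump_pos by (simp add: test_bump.rep_eq)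
  have zero: "?f t = 0" if "\<not> (b < t \<and> t < x)" for t
    using bump_eq_0[OF that] by (simp add: test_bump.rep_eq)
  have nonneg: "0 \<le> ?f t" for t
    using pos[of t] zero[of t] by fastforce
  have "(LINT t|lborel. ?f t) = 0"
    using fun_cong[OF assms(2), of "test_bump b x"] by (simp add: regular_distribution_def)
  then have "AE t in lborel. ?f t = 0"
    using integral_nonneg_eq_0_iff_AE[OF integrable_mult_test_fun[OF F]] nonneg by simp
  then have "AE t in lborel. t \<notin> {b<..<x}"
    by eventually_elim (use pos in force)
  then have "emeasure lborel {b<..<x} = 0"
    by (subst (asm) AE_iff_measurable[where N = "{b<..<x}"]) auto
  then show False using b(1) by simp
qed

lemma regular_distribution_eq_0_imp:
  assumes F: "F \<in> B_r" and "regular_distribution F = 0"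
  shows "F = 0"
proof (rule B_r_eqI)
  show "0 \<in> B_r" using subspace_B_r by (rule subspace_0)
  fix t
  have neg: "(-1) *\<^sub>R F \<in> B_r"
    using subspace_B_r F by (rule subspace_scale)
  have "regular_distribution ((-1) *\<^sub>R F) = 0"
    unfolding regular_distribution_scaleR assms(2) by simp
  from regular_distribution_eq_0_imp_nonpos[OF neg this, of t]
    regular_distribution_eq_0_imp_nonpos[OF assms, of t]
  show "F (ereal t) = 0 (ereal t)"
    by (simp add: scaleR_fun_def)
qed fact

text \<open>Derivatives are stripped off one at a time: each lower-order derivative of
  \<open>F\<close> vanishes at -\<infinity>, so it is 0 once its own derivative is 0.\<close>

lemma distribution_deriv_n_eq_0_imp:
  assumes F: "F \<in> B_r" and "distribution_deriv_n n F = 0"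
  shows "F = 0"
  using assms(2)
proof (induction n)
  case 0
  then show ?case unfolding distribution_deriv_n_0 by (rule regular_distribution_eq_0_imp[OF F])
next
  case (Suc n)
  then show ?case
    using distribution_deriv_eq_0_imp[OF distribution_deriv_n_in_distributions[OF F]
        distribution_deriv_n_vanishes_at_minus_infinity[OF F]]
    by (simp only: distribution_deriv_n_Suc)
qed

lemma inj_on_distribution_deriv_n: "inj_on (distribution_deriv_n n) B_r"
proof (rule inj_onI)
  fix F G assume F: "F \<in> B_r" and G: "G \<in> B_r" and eq: "distribution_deriv_n n F = distribution_deriv_n n G"
  have neg: "(-1) *\<^sub>R G \<in> B_r"
    using subspace_B_r G by (rule subspace_scale)
  have "distribution_deriv_n n (F + (-1) *\<^sub>R G) = 0"
    unfolding distribution_deriv_n_add[OF F neg] distribution_deriv_n_scaleR eq by simp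
  then have "F + (-1) *\<^sub>R G = 0"
    by (rule distribution_deriv_n_eq_0_imp[OF subspace_add[OF subspace_B_r F neg]])
  then show "F = G" by simp
qed

section \<open>Transport of structure\<close>

lemma commutative_banach_algebra_on_image:
  assumes "commutative_banach_algebra_on S mul nrm"
    and add: "\<And>x y. x \<in> S \<Longrightarrow> y \<in> S \<Longrightarrow> \<Phi> (x + y) = \<Phi> x + \<Phi> y"
    and scale: "\<And>c x. x \<in> S \<Longrightarrow> \<Phi> (c *\<^sub>R x) = c *\<^sub>R \<Phi> x"
    and mul: "\<And>x y. x \<in> S \<Longrightarrow> y \<in> S \<Longrightarrow> mul' (\<Phi> x) (\<Phi> y) = \<Phi> (mul x y)"
    and nrm: "\<And>x. x \<in> S \<Longrightarrow> nrm' (\<Phi> x) = nrm x"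
  shows "commutative_banach_algebra_on (\<Phi> ` S) mul' nrm'"
proof -
  interpret commutative_banach_algebra_on S mul nrm by fact
  note S = subspace_add[OF subspace_carrier] subspace_scale[OF subspace_carrier]
    subspace_0[OF subspace_carrier] mul_closed
  \<comment> \<open>Additivity and homogeneity hold only on \<open>S\<close>, so the difference is
    treated as \<open>x + (-1) *\<^sub>R y\<close>.\<close>
  have diff: "x - y \<in> S \<and> \<Phi> (x - y) = \<Phi> x - \<Phi> y" if "x \<in> S" "y \<in> S" for x y
    using add[OF that(1) S(2)[OF that(2), of "-1"]] scale[OF that(2), of "-1"]
      subspace_diff[OF subspace_carrier that] by simp
  have zero: "\<Phi> 0 = 0"
    using scale[OF S(3), of 0] by simp
  show ?thesis
  proof
    show "subspace (\<Phi> ` S)"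
    proof (rule subspaceI)
      show "0 \<in> \<Phi> ` S" using zero S(3) by force
    qed (auto simp: S simp flip: add scale intro!: imageI)
    show "nrm' x = 0 \<longleftrightarrow> x = 0" if x: "x \<in> \<Phi> ` S" for x
    proof -
      obtain y where y: "x = \<Phi> y" "y \<in> S" using x by blast
      show ?thesis
      proof
        assume "nrm' x = 0"
        then have "y = 0" using nrm nrm_eq_0_iff y by simp
        then show "x = 0" by (simp add: y zero)
      next
        assume "x = 0"
        then show "nrm' x = 0" using nrm[OF S(3)] nrm_eq_0_iff[OF S(3)] zero by simp
      qed
    qed
  next
    fix X :: "nat \<Rightarrow> 'b"
    assume X: "\<And>k. X k \<in> \<Phi> ` S"
      and Cauchy: "\<And>e. 0 < e \<Longrightarrow> \<exists>M. \<forall>j\<ge>M. \<forall>k\<ge>M. nrm' (X j - X k) < e"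
    \<comment> \<open>Since \<Phi> preserves norms of differences, a Cauchy sequence in the image
      lifts to one in \<open>S\<close>, and the limit there is mapped back.\<close>
    obtain Y where Y: "\<And>k. Y k \<in> S" "\<And>k. X k = \<Phi> (Y k)"
      using X unfolding image_iff by metis
    have nrm_diff: "nrm' (\<Phi> x - \<Phi> y) = nrm (x - y)" if "x \<in> S" "y \<in> S" for x y
      using diff[OF that] nrm by metis
    have "\<exists>M. \<forall>j\<ge>M. \<forall>k\<ge>M. nrm (Y j - Y k) < e" if "0 < e" for e
      using Cauchy[OF that] by (simp add: Y nrm_diff)
    from complete_carrier[OF Y(1) this] obtain y where "y \<in> S" "(\<lambda>k. nrm (Y k - y)) \<longlonglongrightarrow> 0"
      by blast
    then show "\<exists>x\<in>\<Phi> ` S. (\<lambda>k. nrm' (X k - x)) \<longlonglongrightarrow> 0"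
      by (intro bexI[of _ "\<Phi> y"]) (simp_all add: Y nrm_diff)
  qed (auto simp: S mul nrm nrm_nonneg nrm_triangle nrm_scaleR mul_assoc mul_add_left mul_add_right
    mul_scaleR_left mul_scaleR_right nrm_mul_le intro!: mul_commute arg_cong[of _ _ \<Phi>]
    simp flip: add scale)
qed

lemma has_unit_on_image:
  assumes inj: "inj_on \<Phi> S"
    and closed: "\<And>x y. x \<in> S \<Longrightarrow> y \<in> S \<Longrightarrow> mul x y \<in> S"
    and mul: "\<And>x y. x \<in> S \<Longrightarrow> y \<in> S \<Longrightarrow> mul' (\<Phi> x) (\<Phi> y) = \<Phi> (mul x y)"
  shows "has_unit_on (\<Phi> ` S) mul' \<longleftrightarrow> has_unit_on S mul"
  unfolding has_unit_on_def using inj_on_eq_iff[OF inj] closed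
  by (simp add: mul cong: bex_cong ball_cong)

lemma has_approximate_identity_on_image:
  assumes "has_approximate_identity_on S mul nrm" "subspace S"
    and closed: "\<And>x y. x \<in> S \<Longrightarrow> y \<in> S \<Longrightarrow> mul x y \<in> S"
    and add: "\<And>x y. x \<in> S \<Longrightarrow> y \<in> S \<Longrightarrow> \<Phi> (x + y) = \<Phi> x + \<Phi> y"
    and scale: "\<And>c x. x \<in> S \<Longrightarrow> \<Phi> (c *\<^sub>R x) = c *\<^sub>R \<Phi> x"
    and mul: "\<And>x y. x \<in> S \<Longrightarrow> y \<in> S \<Longrightarrow> mul' (\<Phi> x) (\<Phi> y) = \<Phi> (mul x y)"
    and nrm: "\<And>x. x \<in> S \<Longrightarrow> nrm' (\<Phi> x) = nrm x"
  shows "has_approximate_identity_on (\<Phi> ` S) mul' nrm'"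
proof -
  obtain u where u: "\<And>k. u k \<in> S" "\<And>v. v \<in> S \<Longrightarrow> (\<lambda>k. nrm (v - mul (u k) v)) \<longlonglongrightarrow> 0"
    using assms(1) unfolding has_approximate_identity_on_def by blast
  have "nrm' (\<Phi> x - \<Phi> y) = nrm (x - y)" if "x \<in> S" "y \<in> S" for x y
  proof -
    have "\<Phi> (x - y) = \<Phi> x - \<Phi> y"
      using add[OF that(1) subspace_scale[OF assms(2) that(2), of "-1"]] scale[OF that(2), of "-1"] by simp
    then show ?thesis using nrm[OF subspace_diff[OF assms(2) that]] by simp
  qed
  then show ?thesis
    unfolding has_approximate_identity_on_def
    by (intro exI[of _ "\<lambda>k. \<Phi> (u k)"]) (auto simp: u mul closed)
qed

lemma banach_algebras_isomorphic_image:
  assumes inj: "inj_on \<Phi> S" and "subspace S"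
    and closed: "\<And>x y. x \<in> S \<Longrightarrow> y \<in> S \<Longrightarrow> mul x y \<in> S"
    and add: "\<And>x y. x \<in> S \<Longrightarrow> y \<in> S \<Longrightarrow> \<Phi> (x + y) = \<Phi> x + \<Phi> y"
    and scale: "\<And>c x. x \<in> S \<Longrightarrow> \<Phi> (c *\<^sub>R x) = c *\<^sub>R \<Phi> x"
    and mul: "\<And>x y. x \<in> S \<Longrightarrow> y \<in> S \<Longrightarrow> mul' (\<Phi> x) (\<Phi> y) = \<Phi> (mul x y)"
    and nrm: "\<And>x. x \<in> S \<Longrightarrow> nrm' (\<Phi> x) = nrm x"
  shows "banach_algebras_isomorphic (\<Phi> ` S) mul' nrm' S mul nrm"
  unfolding banach_algebras_isomorphic_def
proof (intro exI conjI)
  \<comment> \<open>The isomorphism sought runs from the image back to \<open>S\<close>, hence the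
    inverse of \<Phi>; in the application it sends a distribution to its primitive.\<close>
  show "bij_betw (inv_into S \<Phi>) (\<Phi> ` S) S"
    using inj by (simp add: bij_betw_inv_into inj_on_imp_bij_betw)
qed (auto simp: inv_into_f_f[OF inj] mul nrm closed subspace_add[OF \<open>subspace S\<close>]
  subspace_scale[OF \<open>subspace S\<close>] simp flip: add scale)

section \<open>Algebras of primitives\<close>

text \<open>Collects what the algebra argument uses about \<open>B_r\<close> and \<open>B_c\<close>,
  so that both are treated by one proof.\<close>

locale primitive_space =
  fixes B :: "(ereal \<Rightarrow> real) set"
  assumes subset_B_r: "B \<subseteq> B_r"
    and subspace: "subspace B"
    and mult_closed: "F \<in> B \<Longrightarrow> G \<in> B \<Longrightarrow> F * G \<in> B"
    and uniform_limit_closed: "(\<And>k. X k \<in> B) \<Longrightarrow> uniform_limit UNIV X F sequentially \<Longrightarrow> F \<in> B"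
    and ramp_in: "ramp k \<in> B"
begin

lemma in_B_r: "F \<in> B \<Longrightarrow> F \<in> B_r"
  using subset_B_r by blast

lemma abs_le: "F \<in> B \<Longrightarrow> \<bar>F x\<bar> \<le> sup_norm F"
  by (intro abs_le_sup_norm in_B_r)

text \<open>The norm bounds values on the whole extended line, so a Cauchy sequence converges
  uniformly there, and \<open>B\<close> is closed under such limits.\<close>

lemma sup_norm_complete:
  assumes X: "\<And>k. X k \<in> B" and Cauchy: "\<And>e. 0 < e \<Longrightarrow> \<exists>M. \<forall>j\<ge>M. \<forall>k\<ge>M. sup_norm (X j - X k) < e"
  shows "\<exists>F\<in>B. (\<lambda>k. sup_norm (X k - F)) \<longlonglongrightarrow> 0"
proof -
  have le: "\<bar>F x - G x\<bar> \<le> sup_norm (F - G)" if "F \<in> B" "G \<in> B" for F G x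
    using abs_le[OF subspace_diff[OF subspace that], of x] by simp
  have "uniformly_Cauchy_on UNIV X"
    unfolding uniformly_Cauchy_on_def dist_real_def
    using Cauchy le[OF X X] by (meson le_less_trans)
  then obtain F where F: "uniform_limit UNIV X F sequentially"
    using Cauchy_uniformly_convergent uniformly_convergent_on_def by blast
  have "F \<in> B" using uniform_limit_closed X F by blast
  moreover have "(\<lambda>k. sup_norm (X k - F)) \<longlonglongrightarrow> 0"
  proof (rule LIMSEQ_I)
    fix e :: real assume "0 < e"
    then have "\<forall>\<^sub>F k in sequentially. \<forall>x\<in>UNIV. dist (X k x) (F x) < e / 2"
      by (intro uniform_limitD[OF F]) simp
    then obtain N where N: "\<And>k x. k \<ge> N \<Longrightarrow> dist (X k x) (F x) < e / 2"
      unfolding eventually_sequentially by blast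
    have "norm (sup_norm (X k - F) - 0) < e" if "k \<ge> N" for k
    proof -
      have "sup_norm (X k - F) \<le> e / 2"
        using N[OF that] by (intro sup_norm_le) (simp add: dist_real_def less_imp_le)
      moreover have "0 \<le> sup_norm (X k - F)"
        using le[OF X \<open>F \<in> B\<close>, of k 0] by linarith
      ultimately show ?thesis using \<open>0 < e\<close> by simp
    qed
    then show "\<exists>N. \<forall>k\<ge>N. norm (sup_norm (X k - F) - 0) < e" by blast
  qed
  ultimately show ?thesis by blast
qed

lemma commutative_banach_algebra: "commutative_banach_algebra_on B (*) sup_norm"
proof
  show "0 \<le> sup_norm F" if "F \<in> B" for F
    using abs_le[OF that, of 0] by linarith
  show "sup_norm F = 0 \<longleftrightarrow> F = 0" if "F \<in> B" for F
  proof
    assume "sup_norm F = 0"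
    then show "F = 0" using abs_le[OF that] by (auto simp: fun_eq_iff)
  qed (simp add: sup_norm_def)
  show "sup_norm (F + G) \<le> sup_norm F + sup_norm G" if "F \<in> B" "G \<in> B" for F G
  proof (rule sup_norm_le)
    fix t show "\<bar>(F + G) (ereal t)\<bar> \<le> sup_norm F + sup_norm G"
      using abs_le[OF that(1), of "ereal t"] abs_le[OF that(2), of "ereal t"] by simp
  qed
  have scale_le: "sup_norm (c *\<^sub>R F) \<le> \<bar>c\<bar> * sup_norm F" if "F \<in> B" for c F
    using abs_le[OF that] by (intro sup_norm_le) (simp add: scaleR_fun_def abs_mult mult_left_mono)
  show "sup_norm (c *\<^sub>R F) = \<bar>c\<bar> * sup_norm F" if F: "F \<in> B" for c F
  proof (rule antisym[OF scale_le[OF F]])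
    show "\<bar>c\<bar> * sup_norm F \<le> sup_norm (c *\<^sub>R F)"
    proof (cases "c = 0")
      case False
      \<comment> \<open>The reverse inequality is the first one applied to the scalar
        \<open>inverse c\<close> and the function \<open>c *\<^sub>R F\<close>.\<close>
      then have "sup_norm F \<le> \<bar>inverse c\<bar> * sup_norm (c *\<^sub>R F)"
        using scale_le[OF subspace_scale[OF subspace F], of "inverse c" c] by simp
      then show ?thesis using False by (simp add: field_simps)
    qed (simp add: sup_norm_def)
  qed
  show "sup_norm (F * G) \<le> sup_norm F * sup_norm G" if "F \<in> B" "G \<in> B" for F G
    using abs_le[OF that(1)] abs_le[OF that(2)]
    by (intro sup_norm_le) (simp add: abs_mult mult_mono')
qed (use subspace sup_norm_complete mult_closed in
  \<open>auto simp: fun_eq_iff scaleR_fun_def algebra_simps\<close>)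

lemma no_unit: "\<not> has_unit_on B (*)"
proof
  assume "has_unit_on B (*)"
  then obtain E where E: "E \<in> B" "\<And>F. F \<in> B \<Longrightarrow> E * F = F"
    unfolding has_unit_on_def by blast
  have "E (ereal t) = 1" for t
  proof -
    \<comment> \<open>A ramp equal to 1 at \<open>t\<close> reads off the value of \<open>E\<close>
      at \<open>t\<close>.\<close>
    obtain k where "1 - t \<le> real k" using real_arch_simple by blast
    then have "ramp k (ereal t) = 1" by (simp add: ramp_real)
    then show ?thesis using fun_cong[OF E(2)[OF ramp_in], of k "ereal t"] by simp
  qed
  then show False
    using B_r_at_bot[OF in_B_r[OF E(1)]] by (simp add: tendsto_const_iff)
qed

text \<open>To the left of \<open>a\<close> the function \<open>F\<close> is small and 1 -
  \<open>ramp k\<close> lies in [0, 1]; to the right the ramp equals 1, so the difference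
  vanishes.\<close>

lemma approximate_identity: "has_approximate_identity_on B (*) sup_norm"
  unfolding has_approximate_identity_on_def
proof (intro exI[of _ ramp] conjI allI ballI ramp_in LIMSEQ_I)
  fix F and e :: real assume F: "F \<in> B" and "0 < e"
  have "\<forall>\<^sub>F t in at_bot. \<bar>F (ereal t)\<bar> < e / 2"
    using \<open>0 < e\<close> by (intro order_tendstoD(2)[OF tendsto_rabs_zero[OF B_r_at_bot[OF in_B_r[OF F]]]]) simp
  then obtain a where a: "\<And>t. t \<le> a \<Longrightarrow> \<bar>F (ereal t)\<bar> < e / 2"
    unfolding eventually_at_bot_linorder by blast
  \<comment> \<open>With this choice the rise of \<open>ramp k\<close>, which ends at 1 - k, lies to
    the left of \<open>a\<close> for all k \<ge> N.\<close>
  obtain N where N: "1 - a \<le> real N" using real_arch_simple by blast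
  have "norm (sup_norm (F - ramp k * F) - 0) < e" if "k \<ge> N" for k
  proof -
    have "\<bar>(F - ramp k * F) (ereal t)\<bar> \<le> e / 2" for t
    proof (cases "t \<le> a")
      case True
      have "\<bar>1 - ramp k (ereal t)\<bar> \<le> 1" by (auto simp: ramp_real)
      then have "\<bar>1 - ramp k (ereal t)\<bar> * \<bar>F (ereal t)\<bar> \<le> 1 * (e / 2)"
        using a[OF True] by (intro mult_mono) auto
      then show ?thesis by (simp add: left_diff_distrib flip: abs_mult)
    next
      case False
      then have "ramp k (ereal t) = 1" using N that by (simp add: ramp_real)
      then show ?thesis using \<open>0 < e\<close> by simp
    qed
    then have "sup_norm (F - ramp k * F) \<le> e / 2" by (rule sup_norm_le)
    moreover have "0 \<le> sup_norm (F - ramp k * F)"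
      using abs_le[OF subspace_diff[OF subspace F mult_closed[OF ramp_in F]], of k 0] by linarith
    ultimately show ?thesis using \<open>0 < e\<close> by simp
  qed
  then show "\<exists>N. \<forall>k\<ge>N. norm (sup_norm (F - ramp k * F) - 0) < e" by blast
qed

lemma integrable_distributions_eq: "integrable_distributions B n = distribution_deriv_n n ` B"
  using distribution_deriv_n_in_distributions in_B_r by (auto simp: integrable_distributions_def)

lemma inj_on_B: "inj_on (distribution_deriv_n n) B"
  using inj_on_distribution_deriv_n subset_B_r by (rule inj_on_subset)

text \<open>Injectivity of the n-fold derivative on \<open>B\<close> makes the definite description
  in \<open>primitive\<close> well defined.\<close>

lemma primitive_deriv: "F \<in> B \<Longrightarrow> primitive B n (distribution_deriv_n n F) = F"
  unfolding primitive_def using inj_onD[OF inj_on_B] by (intro the_equality) auto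

text \<open>By \<open>primitive_deriv\<close>, the multiplication and the norm on distributions are
  exactly those carried over from \<open>B\<close> by the injective linear map
  \<open>distribution_deriv_n n\<close>, so the transport lemmas apply.\<close>

lemma distribution_algebra:
  "commutative_banach_algebra_on (integrable_distributions B n) (distribution_mult B n) (distribution_norm B n) \<and>
   \<not> has_unit_on (integrable_distributions B n) (distribution_mult B n) \<and>
   has_approximate_identity_on (integrable_distributions B n) (distribution_mult B n) (distribution_norm B n) \<and>
   banach_algebras_isomorphic
     (integrable_distributions B n) (distribution_mult B n) (distribution_norm B n) B (*) sup_norm"
proof -
  have add: "distribution_deriv_n n (F + G) = distribution_deriv_n n F + distribution_deriv_n n G"
    if "F \<in> B" "G \<in> B" for F G
    using that by (intro distribution_deriv_n_add in_B_r)
  have mul: "distribution_mult B n (distribution_deriv_n n F) (distribution_deriv_n n G)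
      = distribution_deriv_n n (F * G)" if "F \<in> B" "G \<in> B" for F G
    using that by (simp add: distribution_mult_def primitive_deriv)
  have nrm: "distribution_norm B n (distribution_deriv_n n F) = sup_norm F" if "F \<in> B" for F
    using that by (simp add: distribution_norm_def primitive_deriv)
  have scale: "distribution_deriv_n n (c *\<^sub>R F) = c *\<^sub>R distribution_deriv_n n F" if "F \<in> B" for c F
    by (rule distribution_deriv_n_scaleR)
  note iso = add scale mul nrm
  have "has_unit_on (distribution_deriv_n n ` B) (distribution_mult B n) \<longleftrightarrow> has_unit_on B (*)"
    by (rule has_unit_on_image[OF inj_on_B]) (simp_all add: mult_closed mul)
  with no_unit show ?thesis
    unfolding integrable_distributions_eq
    by (intro conjI commutative_banach_algebra_on_image[OF commutative_banach_algebra]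
        has_approximate_identity_on_image[OF approximate_identity subspace]
        banach_algebras_isomorphic_image[OF inj_on_B subspace])
      (simp_all add: iso mult_closed)
qed

end

theorem theorem24:
  fixes n :: nat
  shows
    "(commutative_banach_algebra_on (A_r n) (distribution_mult B_r n) (distribution_norm B_r n) \<and>
      \<not> has_unit_on (A_r n) (distribution_mult B_r n) \<and>
      has_approximate_identity_on (A_r n) (distribution_mult B_r n) (distribution_norm B_r n) \<and>
      banach_algebras_isomorphic
        (A_r n) (distribution_mult B_r n) (distribution_norm B_r n) B_r (*) sup_norm) \<and>
     (commutative_banach_algebra_on (A_c n) (distribution_mult B_c n) (distribution_norm B_c n) \<and>
      \<not> has_unit_on (A_c n) (distribution_mult B_c n) \<and>
      has_approximate_identity_on (A_c n) (distribution_mult B_c n) (distribution_norm B_c n) \<and>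
      banach_algebras_isomorphic
        (A_c n) (distribution_mult B_c n) (distribution_norm B_c n) B_c (*) sup_norm)"
proof -
  have "primitive_space B_r"
    using subspace_B_r B_r_mult B_r_uniform_limit ramp_in_B_c B_c_subset_B_r
    by unfold_locales auto
  moreover have "primitive_space B_c"
    using subspace_B_c B_c_mult B_c_uniform_limit ramp_in_B_c B_c_subset_B_r
    by unfold_locales auto
  ultimately show ?thesis
    unfolding A_r_def A_c_def by (intro conjI[of "_ \<and> _"] primitive_space.distribution_algebra)
qed

end
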